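(* Let $\mathcal{K}\subseteq\mathbb{R}^n$ be a closed convex set with $\mathbf{0}\in\mathcal{K}$ and $\|\mathbf{x}-\mathbf{y}\|_2\le D$ for all $\mathbf{x},\mathbf{y}\in\mathcal{K}$. Let $T\ge1$ be such that $K=T^{1/3}$ is an integer (so $T/K$ is an integer). Let $f_1,\dots,f_T:\mathcal{K}\to\mathbb{R}$ be convex (differentiable) functions that are $\alpha$-smooth over $\mathcal{K}$ and satisfy $\|\nabla f_t(\mathbf{x})\|_2\le G$ for all $\mathbf{x}\in\mathcal{K}$, $t\in[T]$ ($G>0$), and let $d_1,\dots,d_T\ge1$ be integer delays with $d=\max\{d_1,\dots,d_T\}$. Suppose the adversary is oblivious, i.e. all loss functions and delays are fixed beforehand, independently of the algorithm's randomness. Let $\mathbf{x}_1,\dots,\mathbf{x}_{T/K}$ be the block decisions of Delayed OSPF (defined in the context) run with $\delta=\frac{2}{\sqrt n\,GT^{2/3}}$ and $K=T^{1/3}$. Then for every $\mathbf{x}^\ast\in\mathcal{K}$, $$\mathbb{E}\left(\sum_{m=1}^{T/K}\sum_{t=(m-1)K+1}^{mK}\bigl(f_t(\mathbf{x}_m)-f_t(\mathbf{x}^\ast)\bigr)\right)\le 4\alpha D^2T^{2/3}+2\sqrt n\,dDG\,T^{1/3}+2\sqrt n\,DG\,T^{2/3}.$$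
   Context: A function $f:\mathcal{K}\to\mathbb{R}$ is $\alpha$-smooth over $\mathcal{K}$ if $\|\nabla f(\mathbf{x})-\nabla f(\mathbf{y})\|_2\le\alpha\|\mathbf{x}-\mathbf{y}\|_2$ for all $\mathbf{x},\mathbf{y}\in\mathcal{K}$. Delayed feedback: the gradient of $f_t$ at the decision played in round $t$ is revealed at the end of round $t+d_t-1$; let $\mathcal{F}_t=\{k\in[T]: k+d_k-1=t\}$ be the set of rounds whose gradients arrive at the end of round $t$. Notation: $[T]=\{1,\dots,T\}$. Delayed OSPF (inputs $\delta>0$ and block size $K$): let $\mathcal{B}=\{\mathbf{x}\in\mathbb{R}^n:\|\mathbf{x}\|_2\le1\}$ and set $\hat{\mathbf{g}}_0=\mathbf{0}$. For each block $m=1,\dots,T/K$: sample $\mathbf{v}_{(m-1)K+1},\dots,\mathbf{v}_{mK}$ independently and uniformly from $\mathcal{B}$ (independent of the past); compute $\mathbf{x}_m^j=\operatorname{argmax}_{\mathbf{x}\in\mathcal{K}}\bigl\langle-\hat{\mathbf{g}}_{(m-1)K}+\frac{\mathbf{v}_{(m-1)K+j}}{\delta},\mathbf{x}\bigr\rangle$ for $j=1,\dots,K$ (the maximizer is almost surely unique) and $\mathbf{x}_m=\frac1K\sum_{j=1}^K\mathbf{x}_m^j$. In every round $t=(m-1)K+1,\dots,mK$ play $\mathbf{x}_m$ (querying $\nabla f_t(\mathbf{x}_m)$), receive $\{\nabla f_k(\mathbf{x}_{m_k}):k\in\mathcal{F}_t\}$, where $m_k=\lceil k/K\rceil$ is the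 block of round $k$, and set $\hat{\mathbf{g}}_t=\hat{\mathbf{g}}_{t-1}+\sum_{k\in\mathcal{F}_t}\nabla f_k(\mathbf{x}_{m_k})$. The expectation is over the random vectors $\mathbf{v}_i$. *)

theory Defs
  imports "HOL-Probability.Probability"
begin

text \<open>
  The feasible set \<open>S\<close> may have empty interior and the losses are only given on \<open>S\<close>, so gradients
  are taken within \<open>S\<close>. Where such a gradient is not unique, \<open>g\<close> is one choice of it.
\<close>

definition has_gradient_on ::
  "('a::euclidean_space \<Rightarrow> real) \<Rightarrow> ('a \<Rightarrow> 'a) \<Rightarrow> 'a set \<Rightarrow> bool" where
  "has_gradient_on f g S \<longleftrightarrow> (\<forall>x\<in>S. (f has_derivative (\<lambda>h. g x \<bullet> h)) (at x within S))"

text \<open>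
  In the library, \<open>\<alpha>-lipschitz_on S g\<close> includes \<open>0 \<le> \<alpha>\<close>. The sign matters only when \<open>S\<close> is a
  singleton, where the inequality alone would permit a negative \<open>\<alpha>\<close>.
\<close>

definition smooth_over ::
  "real \<Rightarrow> ('a::euclidean_space \<Rightarrow> real) \<Rightarrow> ('a \<Rightarrow> 'a) \<Rightarrow> 'a set \<Rightarrow> bool" where
  "smooth_over \<alpha> f g S \<longleftrightarrow> has_gradient_on f g S \<and> \<alpha>-lipschitz_on S g"

definition arrivals :: "nat \<Rightarrow> (nat \<Rightarrow> nat) \<Rightarrow> nat \<Rightarrow> nat set" where
  "arrivals T d t = {k \<in> {1..T}. k + d k - 1 = t}"

definition block_of :: "nat \<Rightarrow> nat \<Rightarrow> nat" where
  "block_of K k = nat \<lceil>real k / real K\<rceil>"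

text \<open>
  The trajectory of the algorithm for one realization \<open>v\<close> of the perturbations: \<open>y m j\<close> is the
  \<open>j\<close>-th maximizer computed in block \<open>m\<close>, \<open>x m\<close> the decision played throughout block \<open>m\<close>, and
  \<open>g t\<close> the sum of the gradients received by the end of round \<open>t\<close>. The function \<open>grad k\<close> is the
  gradient of the \<open>k\<close>-th loss. The maximizer is almost surely unique; ties may be broken arbitrarily.
\<close>

definition delayed_ospf ::
  "'a::euclidean_space set \<Rightarrow> nat \<Rightarrow> nat \<Rightarrow> real \<Rightarrow> (nat \<Rightarrow> 'a \<Rightarrow> 'a) \<Rightarrow> (nat \<Rightarrow> nat)
    \<Rightarrow> (nat \<Rightarrow> 'a) \<Rightarrow> (nat \<Rightarrow> nat \<Rightarrow> 'a) \<Rightarrow> (nat \<Rightarrow> 'a) \<Rightarrow> (nat \<Rightarrow> 'a) \<Rightarrow> bool" where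
  "delayed_ospf S T K \<delta> grad d v y x g \<longleftrightarrow>
     g 0 = 0 \<and>
     (\<forall>m\<in>{1..T div K}. \<forall>j\<in>{1..K}.
        is_arg_max (\<lambda>z. (- g ((m - 1) * K) + v ((m - 1) * K + j) /\<^sub>R \<delta>) \<bullet> z) (\<lambda>z. z \<in> S) (y m j)) \<and>
     (\<forall>m\<in>{1..T div K}. x m = (1 / real K) *\<^sub>R (\<Sum>j=1..K. y m j)) \<and>
     (\<forall>t\<in>{1..T}. g t = g (t - 1) + (\<Sum>k\<in>arrivals T d t. grad k (x (block_of K k))))"

end

theory Submission
  imports Defs
begin

text \<open>
  Let \<open>w(g)\<close> be the mean of a maximizer for the objective \<open>- g\<close> perturbed by uniform noise. Given the
  past, \<open>x\<^sub>m\<close> is an average of \<open>K\<close> independent samples with mean \<open>w\<^sub>m = w(g)\<close>, where \<open>g\<close> is the sum of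
  the gradients received before block \<open>m\<close>. So \<open>x\<^sub>m - w\<^sub>m\<close> has variance at most \<open>4D\<^sup>2/K\<close>, and replacing \<open>x\<^sub>m\<close> by \<open>w\<^sub>m\<close> in the linearized regret costs \<open>4\<alpha>D\<^sup>2/K\<close> per
  round: the gradient at \<open>w\<^sub>m\<close> is uncorrelated with \<open>x\<^sub>m - w\<^sub>m\<close> and smoothness controls the rest.
  For the losses that were actually observed, the decisions \<open>w\<close> that look at all gradients up to
  and including the current block have regret at most \<open>D/\<delta>\<close>, by telescoping the support function.
  Finally \<open>w\<close> is Lipschitz with constant \<open>n D \<delta> / 2\<close>: the unit ball and its translate by \<open>s\<close> both contain
  a ball of radius \<open>1 - |s|/2\<close>, whose volume is bounded below by Bernoulli's inequality. At most
  \<open>K + d\<close> gradients are missing in each block, which bounds the cost of the delay.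
\<close>

subsection \<open>Translates of the uniform distribution on the ball\<close>

abbreviation (input) unif_ball :: "'a::euclidean_space measure" where
  "unif_ball \<equiv> uniform_measure lborel (cball 0 1)"

lemma measure_unit_cball_pos: "measure lborel (cball (0::'a::euclidean_space) 1) > 0"
  by (simp add: content_cball)

lemma prob_space_unif_ball: "prob_space (unif_ball :: 'a::euclidean_space measure)"
  by (rule prob_space_uniform_measure) (simp_all add: emeasure_cball less_imp_neq[THEN not_sym])

text \<open>As a normalized Lebesgue integral, the mean over the ball becomes accessible to the
  translation invariance of \<open>lborel\<close>.\<close>

lemma integral_unif_ball:
  fixes \<phi> :: "'a::euclidean_space \<Rightarrow> real"
  assumes [measurable]: "\<phi> \<in> borel_measurable borel"
  shows "(\<integral>u. \<phi> u \<partial>unif_ball) =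
    (\<integral>u. indicator (cball 0 1) u * \<phi> u \<partial>lborel) / measure lborel (cball (0::'a) 1)"
proof -
  have e: "emeasure lborel (cball (0::'a) 1) = ennreal (measure lborel (cball (0::'a) 1))"
    by (rule emeasure_eq_ennreal_measure) (simp add: emeasure_cball)
  have [measurable]: "(cball 0 1 :: 'a set) \<in> sets borel" by simp
  have "indicator (cball 0 1) u / emeasure lborel (cball (0::'a) 1) =
      ennreal (indicator (cball 0 1) u / measure lborel (cball (0::'a) 1))" for u :: 'a
    unfolding e by (auto simp: indicator_def divide_ennreal[symmetric] measure_unit_cball_pos)
  then have "(unif_ball :: 'a measure) =
      density lborel (\<lambda>u. ennreal (indicator (cball 0 1) u / measure lborel (cball (0::'a) 1)))"
    unfolding uniform_measure_def by simp
  then have "(\<integral>u. \<phi> u \<partial>unif_ball) =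
      (\<integral>u. (indicator (cball 0 1) u / measure lborel (cball (0::'a) 1)) *\<^sub>R \<phi> u \<partial>lborel)"
    by (simp only:) (rule integral_density; measurable; simp)
  then show ?thesis by simp
qed

text \<open>The factor \<open>DIM('a) * norm s / 2\<close> bounds the total variation distance
  between the uniform distribution and its translate. It multiplies the oscillation
  \<open>hi - lo\<close> because constants cancel in the difference.\<close>

lemma unif_ball_shift:
  fixes \<phi> :: "'a::euclidean_space \<Rightarrow> real"
  assumes [measurable]: "\<phi> \<in> borel_measurable borel"
    and lo: "\<And>u. lo \<le> \<phi> u" and hi: "\<And>u. \<phi> u \<le> hi"
  shows "(\<integral>u. \<phi> u \<partial>unif_ball) - (\<integral>u. \<phi> (u - s) \<partial>unif_ball)
    \<le> (hi - lo) * (DIM('a) * norm s / 2)"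
proof -
  interpret P: prob_space "unif_ball :: 'a measure" by (rule prob_space_unif_ball)
  have hilo: "lo \<le> hi" using lo hi order_trans by blast
  have bd: "\<bar>\<phi> u\<bar> \<le> \<bar>lo\<bar> + \<bar>hi\<bar>" for u
    using lo[of u] hi[of u] by linarith
  have int: "integrable unif_ball \<phi>" "integrable unif_ball (\<lambda>u. \<phi> (u - s))"
    by (intro P.integrable_const_bound[where B="\<bar>lo\<bar> + \<bar>hi\<bar>"] AE_I2; simp add: bd)+
  show ?thesis
  proof (cases "norm s \<le> 2")
    case False
    \<comment> \<open>For such a long shift the factor exceeds 1, so the oscillation alone is
      enough.\<close>
    have "(\<integral>u. \<phi> u \<partial>unif_ball) - (\<integral>u. \<phi> (u - s) \<partial>unif_ball) \<le> hi - lo"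
      using P.integral_le_const[OF int(1), of hi] P.integral_ge_const[OF int(2), of lo] lo hi
      by simp
    also have "\<dots> \<le> (hi - lo) * (DIM('a) * norm s / 2)"
    proof -
      have "1 * 2 \<le> real DIM('a) * norm s"
        using False DIM_positive[where 'a='a] by (intro mult_mono) (auto simp: Suc_le_eq)
      then show ?thesis
        using hilo mult_left_mono[of 1 "DIM('a) * norm s / 2" "hi - lo"] by simp
    qed
    finally show ?thesis .
  next
    case True
    define B where "B = cball (0::'a) 1"
    \<comment> \<open>The centre is the midpoint of the centres \<open>0\<close> and
      \<open>- s\<close> of the two unit balls; the radius is the largest for which the ball fits
      into both.\<close>
    define C where "C = cball (- s /\<^sub>R 2) (1 - norm s / 2)"
    define V where "V = measure lborel B"
    have V: "V > 0" by (simp add: V_def B_def content_cball)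
    have shift: "(\<lambda>u. u + s) -` B = cball (- s) 1"
      by (auto simp: B_def dist_norm norm_minus_commute add.commute)
    have fin: "emeasure lborel B < \<infinity>" "emeasure lborel C < \<infinity>"
      "emeasure lborel ((\<lambda>u. u + s) -` B) < \<infinity>"
      unfolding shift unfolding B_def C_def by (rule emeasure_lborel_cball_finite)+
    have [measurable]: "B \<in> sets borel" "C \<in> sets borel" "(\<lambda>u. u + s) -` B \<in> sets borel"
      unfolding shift by (simp_all add: B_def C_def)
    have CB: "C \<subseteq> B" "C \<subseteq> (\<lambda>u. u + s) -` B"
    proof -
      show "C \<subseteq> B"
        unfolding C_def B_def by (auto simp: cball_subset_cball_iff)
      show "C \<subseteq> (\<lambda>u. u + s) -` B"
      proof
        fix u assume "u \<in> C"
        then have "norm (u + s /\<^sub>R 2) \<le> 1 - norm s / 2"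
          by (simp add: C_def dist_norm norm_minus_commute)
        moreover have "norm (u + s) \<le> norm (u + s /\<^sub>R 2) + norm (s /\<^sub>R 2)"
          using norm_triangle_ineq[of "u + s /\<^sub>R 2" "s /\<^sub>R 2"]
          by (simp add: add.assoc scaleR_left_distrib[symmetric])
        ultimately show "u \<in> (\<lambda>u. u + s) -` B" by (simp add: B_def)
      qed
    qed
    have ind: "integrable lborel (\<lambda>u. indicator A u * \<psi> u)"
      if "A \<in> sets borel" "emeasure lborel A < \<infinity>" "\<psi> \<in> borel_measurable borel"
        "\<And>u. lo \<le> \<psi> u" "\<And>u. \<psi> u \<le> hi" for A :: "'a set" and \<psi> :: "'a \<Rightarrow> real"
    proof -
      have "\<bar>\<psi> u\<bar> \<le> \<bar>lo\<bar> + \<bar>hi\<bar>" for u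
        using that(4,5)[of u] by linarith
      then show ?thesis
        using integrableI_bounded_set_indicator[of A lborel \<psi> "\<bar>lo\<bar> + \<bar>hi\<bar>"] that(1-3)
        by simp
    qed
    have trans: "(\<integral>u. indicator B u * \<psi> (u - s) \<partial>lborel)
        = (\<integral>u. indicator ((\<lambda>u. u + s) -` B) u * \<psi> u \<partial>lborel)"
      if "\<psi> \<in> borel_measurable borel" for \<psi> :: "'a \<Rightarrow> real"
    proof -
      have "(\<integral>u. indicator B u * \<psi> (u - s) \<partial>lborel)
          = (\<integral>u. indicator B u * \<psi> (u - s) \<partial>distr lborel borel ((+) s))"
        by (simp add: lborel_distr_plus)
      also have "\<dots> = (\<integral>u. indicator ((\<lambda>u. u + s) -` B) u * \<psi> u \<partial>lborel)"
        using that by (subst integral_distr) (auto simp: indicator_def add.commute)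
      finally show ?thesis .
    qed
    have VB: "measure lborel ((\<lambda>u. u + s) -` B) = V"
      using trans[of "\<lambda>_. 1"] by (simp add: V_def)
    have "V * ((\<integral>u. \<phi> u \<partial>unif_ball) - (\<integral>u. \<phi> (u - s) \<partial>unif_ball))
      = (\<integral>u. indicator B u * \<phi> u \<partial>lborel)
        - (\<integral>u. indicator ((\<lambda>u. u + s) -` B) u * \<phi> u \<partial>lborel)"
      using V trans[of \<phi>] integral_unif_ball[of \<phi>] integral_unif_ball[of "\<lambda>u. \<phi> (u - s)"]
      unfolding B_def[symmetric] V_def[symmetric] by (simp add: right_diff_distrib)
    also have "\<dots> = (\<integral>u. indicator B u * (\<phi> u - lo) - indicator ((\<lambda>u. u + s) -` B) u * (\<phi> u - lo) \<partial>lborel)"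
      using ind[OF _ fin(1), of \<phi>] ind[OF _ fin(3), of \<phi>] ind[OF _ fin(1), of "\<lambda>_. lo"]
        ind[OF _ fin(3), of "\<lambda>_. lo"] lo hi hilo VB
      by (simp add: right_diff_distrib V_def)
    also have "\<dots> \<le> (\<integral>u. (hi - lo) * (indicator B u - indicator C u) \<partial>lborel)"
    proof (rule integral_mono)
      show "integrable lborel (\<lambda>u. indicator B u * (\<phi> u - lo) - indicator ((\<lambda>u. u + s) -` B) u * (\<phi> u - lo))"
        using ind[OF _ fin(1), of \<phi>] ind[OF _ fin(3), of \<phi>] ind[OF _ fin(1), of "\<lambda>_. lo"]
          ind[OF _ fin(3), of "\<lambda>_. lo"] lo hi hilo
        by (simp add: right_diff_distrib)
      show "integrable lborel (\<lambda>u. (hi - lo) * (indicator B u - indicator C u))"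
        using fin by simp
      show "indicator B u * (\<phi> u - lo) - indicator ((\<lambda>u. u + s) -` B) u * (\<phi> u - lo)
          \<le> (hi - lo) * (indicator B u - indicator C u)" for u
        using CB lo[of u] hi[of u] by (auto simp: indicator_def)
    qed
    also have "\<dots> = (hi - lo) * (V - measure lborel C)"
      using fin by (simp add: V_def)
    also have "\<dots> = V * ((hi - lo) * (1 - (1 - norm s / 2) ^ DIM('a)))"
      using True by (simp add: V_def B_def C_def content_cball algebra_simps)
    also have "\<dots> \<le> V * ((hi - lo) * (DIM('a) * norm s / 2))"
      using V hilo True Bernoulli_inequality[of "- norm s / 2" "DIM('a)"]
      by (intro mult_left_mono) auto
    finally show ?thesis using V by simp
  qed
qed

subsection \<open>Perturbed linear maximization\<close>

locale bounded_domain =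
  fixes S :: "'a::euclidean_space set" and D :: real
  assumes compact: "compact S" and convex: "convex S" and zero: "0 \<in> S"
    and diam: "\<And>a b. a \<in> S \<Longrightarrow> b \<in> S \<Longrightarrow> norm (a - b) \<le> D"
begin

lemma D_nonneg: "0 \<le> D" using diam[OF zero zero] by simp

lemma norm_le: "z \<in> S \<Longrightarrow> norm z \<le> D" using diam[OF _ zero] by simp

section \<open>Maximizers and the support function\<close>

abbreviation maximizer :: "'a \<Rightarrow> 'a \<Rightarrow> bool" where
  "maximizer u \<equiv> is_arg_max ((\<bullet>) u) (\<lambda>z. z \<in> S)"

lemma maximizer_iff: "maximizer u z \<longleftrightarrow> z \<in> S \<and> (\<forall>z'\<in>S. u \<bullet> z' \<le> u \<bullet> z)"
  by (auto simp: is_arg_max_linorder)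

lemma maximizer_exists: "\<exists>z. maximizer u z"
proof -
  have "\<exists>z\<in>S. \<forall>z'\<in>S. u \<bullet> z' \<le> u \<bullet> z"
    using zero by (intro continuous_attains_sup[OF compact]) (auto intro!: continuous_intros)
  then show ?thesis by (auto simp: maximizer_iff)
qed

text \<open>The support function of \<open>S\<close>, evaluated at a chosen maximizer;
  \<open>support_eq\<close> shows that the choice is immaterial.\<close>

definition support :: "'a \<Rightarrow> real" where
  "support u = u \<bullet> (SOME z. maximizer u z)"

lemma support_eq: "maximizer u z \<Longrightarrow> support u = u \<bullet> z"
  unfolding support_def using someI_ex[OF maximizer_exists[of u]]
  by (metis maximizer_iff order_antisym)

lemma inner_le_support: "z \<in> S \<Longrightarrow> u \<bullet> z \<le> support u"
  using maximizer_exists[of u] by (auto simp: support_eq maximizer_iff)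

lemma support_add_le: "support (u + c) \<le> support u + norm c * D"
proof -
  obtain z where z: "maximizer (u + c) z" using maximizer_exists by blast
  then have zS: "z \<in> S" by (simp add: maximizer_iff)
  have "c \<bullet> z \<le> norm c * norm z" by (rule norm_cauchy_schwarz)
  also have "\<dots> \<le> norm c * D" using norm_le[OF zS] by (intro mult_left_mono) auto
  finally show ?thesis
    using inner_le_support[OF zS, of u] support_eq[OF z] by (simp add: inner_add_left)
qed

lemma support_lipschitz: "\<bar>support u - support u'\<bar> \<le> D * norm (u - u')"
  using support_add_le[of u' "u - u'"] support_add_le[of u "u' - u"]
  by (simp add: norm_minus_commute[of u' u] mult.commute[of D] abs_le_iff)

lemma support_borel [measurable]: "support \<in> borel_measurable borel"
proof -
  have "D-lipschitz_on UNIV support"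
    using support_lipschitz D_nonneg by (intro lipschitz_onI) (auto simp: dist_norm)
  then show ?thesis
    by (intro borel_measurable_continuous_onI lipschitz_on_continuous_on)
qed

section \<open>Difference quotients and almost sure uniqueness of the maximizer\<close>

definition quot :: "real \<Rightarrow> 'a \<Rightarrow> 'a \<Rightarrow> real" where
  "quot t e u = (support (u + t *\<^sub>R e) - support u) / t"

lemma quot_borel [measurable]: "quot t e \<in> borel_measurable borel"
  unfolding quot_def by measurable

lemma abs_quot_le: "t > 0 \<Longrightarrow> \<bar>quot t e u\<bar> \<le> D * norm e"
  using support_lipschitz[of "u + t *\<^sub>R e" u]
  by (simp add: quot_def pos_divide_le_eq mult_ac)

text \<open>A maximizer at \<open>u\<close> is a subgradient of the convex function
  \<open>support\<close> there. Hence forward quotients lie above its component along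
  \<open>e\<close>, and in \<open>quot_le_inner\<close> the quotients over steps ending at
  \<open>u\<close> lie below it.\<close>

lemma inner_le_quot: "maximizer u z \<Longrightarrow> t > 0 \<Longrightarrow> z \<bullet> e \<le> quot t e u"
  using inner_le_support[of z "u + t *\<^sub>R e"]
  by (simp add: quot_def support_eq maximizer_iff pos_le_divide_eq inner_add_left
      inner_commute[of z] inner_add_right inner_diff_right mult.commute)

lemma quot_le_inner: "maximizer u z \<Longrightarrow> t > 0 \<Longrightarrow> quot t e (u - t *\<^sub>R e) \<le> z \<bullet> e"
  using inner_le_support[of z "u - t *\<^sub>R e"]
  by (simp add: quot_def support_eq maximizer_iff pos_divide_le_eq inner_diff_left
      inner_commute[of z] inner_add_right inner_diff_right mult.commute)

text \<open>Every maximizer lies between the difference quotients to the right and to the left, so it is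
  unique where their gap tends to 0. One quotient being a small translate of the other, the mean of
  the gap over a ball tends to 0.\<close>

definition gap :: "nat \<Rightarrow> 'a \<Rightarrow> 'a \<Rightarrow> real" where
  "gap k e u = quot (1 / Suc k) e u - quot (1 / Suc k) e (u - (1 / Suc k) *\<^sub>R e)"

lemma gap_borel [measurable]: "gap k e \<in> borel_measurable borel"
  unfolding gap_def by measurable

lemma gap_nonneg: "0 \<le> gap k e u"
proof -
  obtain z where "maximizer u z" using maximizer_exists by blast
  then show ?thesis
    using inner_le_quot[of u z "1 / Suc k" e] quot_le_inner[of u z "1 / Suc k" e]
    by (simp add: gap_def)
qed

text \<open>Moving the objective by \<open>(1 / Suc k) *\<^sub>R e\<close> amounts to moving the
  noise by that vector divided by \<open>r\<close>. So \<open>unif_ball_shift\<close> bounds the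
  mean of the \<open>k\<close>-th gap by a multiple of \<open>1 / Suc k\<close>, and the infimum of
  the gaps, being nonnegative with mean 0, vanishes almost everywhere.\<close>

lemma AE_INF_gap:
  assumes r: "r > 0"
  shows "AE v in unif_ball. (INF k. ennreal (gap k e (c + r *\<^sub>R v))) = 0"
proof -
  interpret P: prob_space "unif_ball :: 'a measure" by (rule prob_space_unif_ball)
  let ?N = "\<integral>\<^sup>+v. (INF k. ennreal (gap k e (c + r *\<^sub>R v))) \<partial>unif_ball"
  have N_le: "?N \<le> ennreal (D * norm e * DIM('a) * norm e / r * inverse (real (Suc k)))" for k
  proof -
    let ?t = "1 / real (Suc k)"
    let ?s = "(?t / r) *\<^sub>R e"
    let ?\<phi> = "\<lambda>v. quot ?t e (c + r *\<^sub>R v)"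
    have arg: "c + r *\<^sub>R v - ?t *\<^sub>R e = c + r *\<^sub>R (v - ?s)" for v
      using r by (simp add: scaleR_diff_right)
    have bd: "\<bar>quot ?t e u\<bar> \<le> D * norm e" for u by (rule abs_quot_le) simp
    have bd': "- (D * norm e) \<le> quot ?t e u" "quot ?t e u \<le> D * norm e" for u
      using bd[of u] by linarith+
    have int: "integrable unif_ball ?\<phi>" "integrable unif_ball (\<lambda>v. ?\<phi> (v - ?s))"
      using bd by (intro P.integrable_const_bound[where B="D * norm e"] AE_I2; simp)+
    have "?N \<le> (\<integral>\<^sup>+v. ennreal (gap k e (c + r *\<^sub>R v)) \<partial>unif_ball)"
      by (intro nn_integral_mono INF_lower) auto
    also have "\<dots> = (\<integral>\<^sup>+v. ennreal (?\<phi> v - ?\<phi> (v - ?s)) \<partial>unif_ball)"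
      unfolding gap_def arg ..
    also have "\<dots> = ennreal (\<integral>v. ?\<phi> v - ?\<phi> (v - ?s) \<partial>unif_ball)"
    proof (rule nn_integral_eq_integral)
      show "AE v in unif_ball. 0 \<le> ?\<phi> v - ?\<phi> (v - ?s)"
      proof (rule AE_I2)
        fix v
        show "0 \<le> ?\<phi> v - ?\<phi> (v - ?s)"
          using gap_nonneg[of k e "c + r *\<^sub>R v"] unfolding gap_def arg .
      qed
    qed (use int in simp)
    also have "(\<integral>v. ?\<phi> v - ?\<phi> (v - ?s) \<partial>unif_ball)
        = (\<integral>v. ?\<phi> v \<partial>unif_ball) - (\<integral>v. ?\<phi> (v - ?s) \<partial>unif_ball)"
      using int by (rule Bochner_Integration.integral_diff)
    also have "\<dots> \<le> (D * norm e - - (D * norm e)) * (DIM('a) * norm ?s / 2)"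
      by (intro unif_ball_shift bd') simp
    also have "\<dots> = D * norm e * DIM('a) * norm e / r * inverse (real (Suc k))"
    proof -
      have "norm ?s = norm e / r * inverse (real (Suc k))"
        using r by (simp add: divide_inverse mult_ac del: of_nat_Suc)
      then show ?thesis by (simp only: divide_inverse) simp
    qed
    finally show ?thesis by (simp add: ennreal_leI)
  qed
  have "(\<lambda>k. ennreal (D * norm e * DIM('a) * norm e / r * inverse (real (Suc k))))
      \<longlonglongrightarrow> ennreal (D * norm e * DIM('a) * norm e / r * 0)"
    by (intro tendsto_ennrealI tendsto_mult_left LIMSEQ_inverse_real_of_nat)
  then have "?N \<le> ennreal (D * norm e * DIM('a) * norm e / r * 0)"
    by (rule LIMSEQ_le_const) (intro exI allI impI N_le)
  then have "?N = 0" by simp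
  moreover have "(\<lambda>v. INF k. ennreal (gap k e (c + r *\<^sub>R v))) \<in> borel_measurable unif_ball"
    by simp
  ultimately show ?thesis by (simp only: nn_integral_0_iff_AE)
qed

text \<open>A sufficient condition for uniqueness, phrased by countable infima so that it is a Borel
  predicate. The basis directions determine all coordinates of the maximizer.\<close>

definition unique_at :: "'a \<Rightarrow> bool" where
  "unique_at u \<longleftrightarrow> (\<forall>e\<in>Basis. (INF k. ennreal (gap k e u)) = 0)"

lemma unique_at_measurable [measurable]: "Measurable.pred borel unique_at"
  unfolding unique_at_def by measurable

lemma AE_unique_at: "r > 0 \<Longrightarrow> AE v in unif_ball. unique_at (c + r *\<^sub>R v)"
  unfolding unique_at_def by (intro AE_ball_countable' AE_INF_gap) (auto intro: countable_finite)

text \<open>Projecting the limit of the difference quotients makes the values feasible everywhere, also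
  where the maximizer is not unique.\<close>

definition selection :: "'a \<Rightarrow> 'a" where
  "selection u = closest_point S (\<Sum>e\<in>Basis. (INF k. quot (1 / Suc k) e u) *\<^sub>R e)"

lemma selection_in: "selection u \<in> S"
  unfolding selection_def using compact zero
  by (intro closest_point_in_set compact_imp_closed) auto

text \<open>The forward quotients lie above \<open>z \<bullet> e\<close> and the backward ones below
  it, so small gaps push the infimum of the forward quotients down to \<open>z \<bullet> e\<close>.
  The coordinates recover \<open>z\<close>, which the projection fixes because it lies in
  \<open>S\<close>.\<close>

lemma selection_eq:
  assumes u: "unique_at u" and z: "maximizer u z"
  shows "selection u = z"
proof -
  have "(INF k. quot (1 / Suc k) e u) = z \<bullet> e" if e: "e \<in> Basis" for e
  proof (rule antisym)
    have ge: "z \<bullet> e \<le> quot (1 / Suc k) e u" for k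
      by (rule inner_le_quot[OF z]) simp
    then have bdd: "bdd_below (range (\<lambda>k. quot (1 / Suc k) e u))"
      by (intro bdd_belowI[of _ "z \<bullet> e"]) (auto simp del: of_nat_Suc)
    show "z \<bullet> e \<le> (INF k. quot (1 / Suc k) e u)"
      using ge by (intro cINF_greatest) auto
    show "(INF k. quot (1 / Suc k) e u) \<le> z \<bullet> e"
    proof (rule field_le_epsilon)
      fix \<epsilon> :: real assume \<epsilon>: "0 < \<epsilon>"
      then have "(INF k. ennreal (gap k e u)) < ennreal \<epsilon>"
        using u e by (simp add: unique_at_def)
      then obtain k where "gap k e u < \<epsilon>"
        by (auto simp: INF_less_iff ennreal_less_iff gap_nonneg)
      moreover have "quot (1 / Suc k) e (u - (1 / Suc k) *\<^sub>R e) \<le> z \<bullet> e"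
        by (rule quot_le_inner[OF z]) simp
      moreover have "(INF k. quot (1 / Suc k) e u) \<le> quot (1 / Suc k) e u"
        by (rule cINF_lower[OF bdd]) simp
      ultimately show "(INF k. quot (1 / Suc k) e u) \<le> z \<bullet> e + \<epsilon>"
        unfolding gap_def by linarith
    qed
  qed
  then have "(\<Sum>e\<in>Basis. (INF k. quot (1 / Suc k) e u) *\<^sub>R e) = z"
    by (simp add: euclidean_representation)
  then show ?thesis
    using z by (simp add: selection_def closest_point_self maximizer_iff)
qed

lemma selection_borel [measurable]: "selection \<in> borel_measurable borel"
proof -
  have "(\<lambda>u. INF k. quot (1 / Suc k) e u) \<in> borel_measurable borel" if "e \<in> Basis" for e
  proof (rule borel_measurable_cINF)
    fix u
    obtain z where "maximizer u z" using maximizer_exists by blast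
    then show "bdd_below (range (\<lambda>k. quot (1 / Suc k) e u))"
      by (intro bdd_belowI[of _ "z \<bullet> e"]) (auto intro!: inner_le_quot)
  qed auto
  moreover have "closest_point S \<in> borel_measurable borel"
    using zero by (intro borel_measurable_continuous_onI continuous_on_closest_point
        convex compact_imp_closed[OF compact]) auto
  ultimately show ?thesis
    unfolding selection_def by measurable
qed

lemma selection_maximizer: "unique_at u \<Longrightarrow> maximizer u (selection u)"
  using maximizer_exists[of u] selection_eq by auto

section \<open>The mean decision and its dependence on the received gradients\<close>

definition mean_decision :: "real \<Rightarrow> 'a \<Rightarrow> 'a" where
  "mean_decision r g = (\<integral>v. selection (- g + r *\<^sub>R v) \<partial>unif_ball)"

lemma norm_selection_le: "norm (selection u) \<le> D"
  using selection_in by (rule norm_le)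

lemma integrable_selection:
  "integrable unif_ball (\<lambda>v. selection (- g + r *\<^sub>R v))"
proof -
  interpret P: prob_space "unif_ball :: 'a measure" by (rule prob_space_unif_ball)
  show ?thesis
    by (intro P.integrable_const_bound[where B=D] AE_I2 norm_selection_le) simp
qed

lemma norm_mean_decision_le: "norm (mean_decision r g) \<le> D"
proof -
  interpret P: prob_space "unif_ball :: 'a measure" by (rule prob_space_unif_ball)
  have "norm (mean_decision r g) \<le> (\<integral>v. norm (selection (- g + r *\<^sub>R v)) \<partial>unif_ball)"
    unfolding mean_decision_def by (rule integral_norm_bound)
  also have "\<dots> \<le> D"
    by (intro P.integral_le_const integrable_norm integrable_selection AE_I2 norm_selection_le)
  finally show ?thesis .
qed

lemma inner_mean_decision:
  "l \<bullet> mean_decision r g = (\<integral>v. l \<bullet> selection (- g + r *\<^sub>R v) \<partial>unif_ball)"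
  unfolding mean_decision_def by (rule integral_inner_right[symmetric]) (rule integrable_selection)

text \<open>Replacing \<open>g\<close> by \<open>g'\<close> translates the noise by a vector of
  length \<open>norm (g - g') / r\<close>, so \<open>unif_ball_shift\<close> applies to the values
  of \<open>l\<close> on the selection. Their oscillation is at most
  \<open>norm l * D\<close>.\<close>

lemma mean_decision_diff_le:
  assumes r: "r > 0"
  shows "l \<bullet> (mean_decision r g - mean_decision r g')
    \<le> norm l * D * (DIM('a) * norm (g - g') / (2 * r))"
proof -
  define s where "s = (g' - g) /\<^sub>R r"
  have arg: "- g' + r *\<^sub>R v = - g + r *\<^sub>R (v - s)" for v
    using r by (simp add: s_def algebra_simps)
  \<comment> \<open>These points realize the largest and the smallest value of \<open>l\<close> on
    \<open>S\<close>, which serve as \<open>hi\<close> and \<open>lo\<close>.\<close>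
  obtain z1 z2 where z: "maximizer l z1" "maximizer (- l) z2"
    using maximizer_exists by meson
  have zS: "z1 \<in> S" "z2 \<in> S" using z by (simp_all add: maximizer_iff)
  have "l \<bullet> (mean_decision r g - mean_decision r g')
      = (\<integral>v. l \<bullet> selection (- g + r *\<^sub>R v) \<partial>unif_ball)
        - (\<integral>v. l \<bullet> selection (- g + r *\<^sub>R (v - s)) \<partial>unif_ball)"
    by (simp only: inner_diff_right inner_mean_decision arg)
  also have "\<dots> \<le> (l \<bullet> z1 - l \<bullet> z2) * (DIM('a) * norm s / 2)"
    using z selection_in by (intro unif_ball_shift) (auto simp: maximizer_iff)
  also have "\<dots> \<le> (norm l * D) * (DIM('a) * norm s / 2)"
  proof (rule mult_right_mono)
    have "l \<bullet> z1 - l \<bullet> z2 \<le> norm l * norm (z1 - z2)"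
      using norm_cauchy_schwarz[of l "z1 - z2"] by (simp add: inner_diff_right)
    also have "\<dots> \<le> norm l * D" using diam[OF zS] by (intro mult_left_mono) auto
    finally show "l \<bullet> z1 - l \<bullet> z2 \<le> norm l * D" .
  qed simp
  also have "\<dots> = norm l * D * (DIM('a) * norm (g - g') / (2 * r))"
  proof -
    have "norm s = norm (g - g') / r"
      using r norm_minus_commute[of g' g] by (simp add: s_def divide_inverse_commute)
    then show ?thesis by simp
  qed
  finally show ?thesis .
qed

lemma mean_decision_borel:
  assumes r: "r > 0"
  shows "mean_decision r \<in> borel_measurable borel"
proof -
  define c where "c = D * DIM('a) / (2 * r)"
  have c: "0 \<le> c" using r D_nonneg by (simp add: c_def)
  have "norm (mean_decision r g - mean_decision r g') \<le> c * norm (g - g')" for g g'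
  proof -
    \<comment> \<open>Testing with the difference itself turns the bound for linear functionals into
      a Lipschitz bound in norm.\<close>
    let ?l = "mean_decision r g - mean_decision r g'"
    have "norm ?l * norm ?l \<le> norm ?l * (c * norm (g - g'))"
      using mean_decision_diff_le[OF r, of ?l g g']
      by (simp add: c_def power2_norm_eq_inner[symmetric] power2_eq_square mult_ac)
    then have "norm ?l \<le> c * norm (g - g')" if "?l \<noteq> 0"
      by (rule mult_left_le_imp_le) (use that in simp)
    then show ?thesis using c by (cases "?l = 0") simp_all
  qed
  then have "c-lipschitz_on UNIV (mean_decision r)"
    using c by (intro lipschitz_onI) (auto simp: dist_norm)
  then show ?thesis
    by (intro borel_measurable_continuous_onI lipschitz_on_continuous_on)
qed

text \<open>By convexity of the support function, \<open>selection u \<bullet> l\<close> is at most its increment from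
  \<open>u\<close> to \<open>u + l\<close>, so that the losses of the decisions looking one step ahead telescope.\<close>

lemma lookahead_regret:
  fixes l :: "nat \<Rightarrow> 'a"
  assumes r: "r > 0" and x: "x \<in> S"
  shows "(\<Sum>m=1..N. l m \<bullet> (mean_decision r (\<Sum>i=1..m. l i) - x)) \<le> D * r"
proof -
  interpret P: prob_space "unif_ball :: 'a measure" by (rule prob_space_unif_ball)
  define L where "L m = (\<Sum>i=1..m. l i)" for m
  have L_Suc: "L (Suc m) = L m + l (Suc m)" for m by (simp add: L_def)
  \<comment> \<open>There are countably many partial sums, so a single null set serves all of
    them.\<close>
  have "AE v in unif_ball. \<forall>m. unique_at (- L m + r *\<^sub>R v)"
    by (subst AE_all_countable) (blast intro: AE_unique_at[OF r])
  moreover have "AE v in unif_ball. v \<in> cball (0::'a) 1"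
    by (rule AE_uniform_measureI) auto
  ultimately have *: "AE v in unif_ball. (\<Sum>m=1..N. l m \<bullet> (selection (- L m + r *\<^sub>R v) - x)) \<le> D * r"
  proof eventually_elim
    case (elim v)
    have step: "(\<Sum>m=1..n. l m \<bullet> selection (- L m + r *\<^sub>R v))
        \<le> support (r *\<^sub>R v) - support (- L n + r *\<^sub>R v)" for n
    proof (induction n)
      case 0
      then show ?case by (simp add: L_def)
    next
      case (Suc n)
      let ?u = "- L (Suc n) + r *\<^sub>R v"
      have u: "- L n + r *\<^sub>R v = ?u + l (Suc n)" by (simp add: L_Suc)
      have "(?u + l (Suc n)) \<bullet> selection ?u \<le> support (- L n + r *\<^sub>R v)"
        unfolding u by (rule inner_le_support) (rule selection_in)
      moreover have "support ?u = ?u \<bullet> selection ?u"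
        using elim(1) by (intro support_eq selection_maximizer) auto
      ultimately have "l (Suc n) \<bullet> selection ?u \<le> support (- L n + r *\<^sub>R v) - support ?u"
        by (simp only: inner_add_left)
      then show ?case using Suc.IH by simp
    qed
    obtain z where z: "maximizer (r *\<^sub>R v) z" using maximizer_exists by blast
    \<comment> \<open>The telescoped sum starts at a value attained at \<open>z\<close> and ends at
      one bounded below by testing with \<open>x\<close>. What remains of the noise is
      \<open>r * (v \<bullet> (z - x))\<close>, at most \<open>D * r\<close> on the unit
      ball.\<close>
    have "support (r *\<^sub>R v) - support (- L N + r *\<^sub>R v)
        \<le> (r *\<^sub>R v) \<bullet> z - (- L N + r *\<^sub>R v) \<bullet> x"
      using inner_le_support[OF x, of "- L N + r *\<^sub>R v"] by (simp add: support_eq[OF z])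
    also have "\<dots> = r * (v \<bullet> (z - x)) + L N \<bullet> x"
      by (simp add: inner_add_left inner_diff_left inner_diff_right right_diff_distrib)
    also have "v \<bullet> (z - x) \<le> norm v * norm (z - x)" by (rule norm_cauchy_schwarz)
    also have "norm v * norm (z - x) \<le> 1 * D"
      using elim(2) z x by (intro mult_mono diam) (auto simp: maximizer_iff)
    finally have "support (r *\<^sub>R v) - support (- L N + r *\<^sub>R v) \<le> D * r + L N \<bullet> x"
      using r by (simp add: mult.commute)
    with step[of N] show ?case
      by (simp add: inner_diff_right sum_subtractf L_def inner_sum_left)
  qed
  have int: "integrable unif_ball (\<lambda>v. l m \<bullet> (selection (- L m + r *\<^sub>R v) - x))" for m
    by (intro integrable_inner_right Bochner_Integration.integrable_diff integrable_selection) simp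
  have "(\<Sum>m=1..N. l m \<bullet> (mean_decision r (L m) - x))
      = (\<integral>v. (\<Sum>m=1..N. l m \<bullet> (selection (- L m + r *\<^sub>R v) - x)) \<partial>unif_ball)"
    unfolding Bochner_Integration.integral_sum[OF int]
  proof (rule sum.cong[OF refl])
    fix m
    have "(\<integral>v. l m \<bullet> (selection (- L m + r *\<^sub>R v) - x) \<partial>unif_ball)
        = l m \<bullet> (\<integral>v. selection (- L m + r *\<^sub>R v) - x \<partial>unif_ball)"
      by (rule integral_inner_right) (intro Bochner_Integration.integrable_diff integrable_selection, simp)
    also have "(\<integral>v. selection (- L m + r *\<^sub>R v) - x \<partial>unif_ball) = mean_decision r (L m) - x"
      unfolding mean_decision_def
      by (subst Bochner_Integration.integral_diff[OF integrable_selection]) (use P.prob_space in simp_all)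
    finally show "l m \<bullet> (mean_decision r (L m) - x)
        = (\<integral>v. l m \<bullet> (selection (- L m + r *\<^sub>R v) - x) \<partial>unif_ball)" ..
  qed
  also have "\<dots> \<le> D * r"
    using int * by (intro P.integral_le_const Bochner_Integration.integrable_sum)
  finally show ?thesis by (simp add: L_def)
qed

text \<open>Each decision is compared with the one that also knows the current loss. The latter has
  regret at most \<open>D * r\<close>, and \<open>mean_decision_diff_le\<close> prices the
  information by which \<open>g m\<close> lags behind.\<close>

lemma delayed_linear_regret:
  fixes l g :: "nat \<Rightarrow> 'a" and A B :: real
  assumes r: "r > 0" and x: "x \<in> S"
    and A: "\<And>m. m \<in> {1..N} \<Longrightarrow> norm (l m) \<le> A"
    and B: "\<And>m. m \<in> {1..N} \<Longrightarrow> norm (g m - (\<Sum>i=1..m. l i)) \<le> B"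
  shows "(\<Sum>m=1..N. l m \<bullet> (mean_decision r (g m) - x))
    \<le> D * r + real N * (A * D * (DIM('a) * B / (2 * r)))"
proof -
  have "l m \<bullet> (mean_decision r (g m) - mean_decision r (\<Sum>i=1..m. l i))
      \<le> A * D * (DIM('a) * B / (2 * r))" if m: "m \<in> {1..N}" for m
  proof -
    have "l m \<bullet> (mean_decision r (g m) - mean_decision r (\<Sum>i=1..m. l i))
        \<le> norm (l m) * D * (DIM('a) * norm (g m - (\<Sum>i=1..m. l i)) / (2 * r))"
      by (rule mean_decision_diff_le[OF r])
    also have "\<dots> \<le> A * D * (DIM('a) * B / (2 * r))"
      using A[OF m] B[OF m] r D_nonneg order_trans[OF norm_ge_zero A[OF m]]
      by (intro mult_mono divide_right_mono) auto
    finally show ?thesis .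
  qed
  then have "(\<Sum>m=1..N. l m \<bullet> (mean_decision r (g m) - mean_decision r (\<Sum>i=1..m. l i)))
      \<le> (\<Sum>m=1..N. A * D * (DIM('a) * B / (2 * r)))"
    by (rule sum_mono)
  moreover have "(\<Sum>m=1..N. l m \<bullet> (mean_decision r (g m) - x))
      = (\<Sum>m=1..N. l m \<bullet> (mean_decision r (g m) - mean_decision r (\<Sum>i=1..m. l i)))
        + (\<Sum>m=1..N. l m \<bullet> (mean_decision r (\<Sum>i=1..m. l i) - x))"
    by (simp add: sum.distrib[symmetric] inner_add_right[symmetric])
  ultimately show ?thesis using lookahead_regret[OF r x, of l N] by simp
qed

end

subsection \<open>Functions of independent noise\<close>

locale independent_noise = prob_space M for M :: "'w measure" +
  fixes v :: "nat \<Rightarrow> 'w \<Rightarrow> 'a::euclidean_space" and I :: "nat set"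
  assumes indep: "indep_vars (\<lambda>_. borel) v I"
begin

text \<open>Only up to a null set, since ties between maximizers may be broken by means other than the noise.\<close>

definition adapted :: "nat set \<Rightarrow> ('w \<Rightarrow> 'b::topological_space) \<Rightarrow> bool" where
  "adapted J X \<longleftrightarrow> J \<subseteq> I \<and>
    (\<exists>F\<in>borel_measurable (PiM J (\<lambda>_. borel)). AE \<omega> in M. X \<omega> = F (\<lambda>i\<in>J. v i \<omega>))"

section \<open>Closure properties of adaptedness\<close>

lemma measurable_noise: "i \<in> I \<Longrightarrow> v i \<in> borel_measurable M"
  using indep by (simp add: indep_vars_def)

lemma adapted_const: "J \<subseteq> I \<Longrightarrow> adapted J (\<lambda>_. c)"
  unfolding adapted_def by (intro conjI bexI[of _ "\<lambda>_. c"]) auto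

lemma adapted_noise: "i \<in> J \<Longrightarrow> J \<subseteq> I \<Longrightarrow> adapted J (v i)"
  unfolding adapted_def by (intro conjI bexI[of _ "\<lambda>f. f i"]) auto

lemma adapted_mono:
  assumes "adapted J X" "J \<subseteq> J'" "J' \<subseteq> I"
  shows "adapted J' X"
proof -
  obtain F where F: "F \<in> borel_measurable (PiM J (\<lambda>_. borel))"
      "AE \<omega> in M. X \<omega> = F (\<lambda>i\<in>J. v i \<omega>)"
    using assms(1) unfolding adapted_def by blast
  have "(\<lambda>f. restrict f J) \<in> PiM J' (\<lambda>_. borel) \<rightarrow>\<^sub>M PiM J (\<lambda>_. borel :: 'a measure)"
    using assms(2) by (rule measurable_restrict_subset)
  then have "(\<lambda>f. F (restrict f J)) \<in> borel_measurable (PiM J' (\<lambda>_. borel))"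
    using F(1) by (rule measurable_compose)
  moreover have "restrict (\<lambda>i\<in>J'. v i \<omega>) J = (\<lambda>i\<in>J. v i \<omega>)" for \<omega>
    using assms(2) by (auto simp: restrict_def fun_eq_iff)
  ultimately show ?thesis
    using assms(3) F(2) unfolding adapted_def
    by (intro conjI bexI[of _ "\<lambda>f. F (restrict f J)"]) auto
qed

lemma adapted_cong_AE:
  assumes "adapted J X" "AE \<omega> in M. Y \<omega> = X \<omega>"
  shows "adapted J Y"
proof -
  obtain F where F: "F \<in> borel_measurable (PiM J (\<lambda>_. borel))"
      "AE \<omega> in M. X \<omega> = F (\<lambda>i\<in>J. v i \<omega>)"
    using assms(1) unfolding adapted_def by blast
  have "AE \<omega> in M. Y \<omega> = F (\<lambda>i\<in>J. v i \<omega>)"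
    using F(2) assms(2) by eventually_elim simp
  then show ?thesis using assms(1) F(1) unfolding adapted_def by blast
qed

lemma adapted_compose:
  assumes "adapted J X" "h \<in> borel_measurable borel"
  shows "adapted J (\<lambda>\<omega>. h (X \<omega>))"
proof -
  obtain F where F: "F \<in> borel_measurable (PiM J (\<lambda>_. borel))"
      "AE \<omega> in M. X \<omega> = F (\<lambda>i\<in>J. v i \<omega>)"
    using assms(1) unfolding adapted_def by blast
  have "AE \<omega> in M. h (X \<omega>) = h (F (\<lambda>i\<in>J. v i \<omega>))"
    using F(2) by eventually_elim simp
  moreover have "(\<lambda>f. h (F f)) \<in> borel_measurable (PiM J (\<lambda>_. borel))"
    using F(1) assms(2) by (rule measurable_compose)
  ultimately show ?thesis using assms(1) unfolding adapted_def
    by (intro conjI bexI[of _ "\<lambda>f. h (F f)"]) auto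
qed

lemma adapted_Pair:
  fixes X :: "'w \<Rightarrow> 'b::second_countable_topology" and Y :: "'w \<Rightarrow> 'c::second_countable_topology"
  assumes "adapted J X" "adapted J Y"
  shows "adapted J (\<lambda>\<omega>. (X \<omega>, Y \<omega>))"
proof -
  obtain F where F: "F \<in> borel_measurable (PiM J (\<lambda>_. borel))"
      "AE \<omega> in M. X \<omega> = F (\<lambda>i\<in>J. v i \<omega>)"
    using assms(1) unfolding adapted_def by blast
  obtain H where H: "H \<in> borel_measurable (PiM J (\<lambda>_. borel))"
      "AE \<omega> in M. Y \<omega> = H (\<lambda>i\<in>J. v i \<omega>)"
    using assms(2) unfolding adapted_def by blast
  have "AE \<omega> in M. (X \<omega>, Y \<omega>) = (F (\<lambda>i\<in>J. v i \<omega>), H (\<lambda>i\<in>J. v i \<omega>))"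
    using F(2) H(2) by eventually_elim simp
  moreover have "(\<lambda>f. (F f, H f)) \<in> borel_measurable (PiM J (\<lambda>_. borel))"
    using F(1) H(1) by (rule borel_measurable_Pair)
  ultimately show ?thesis using assms(1) unfolding adapted_def
    by (intro conjI bexI[of _ "\<lambda>f. (F f, H f)"]) auto
qed

lemma adapted_compose2:
  fixes X :: "'w \<Rightarrow> 'b::second_countable_topology" and Y :: "'w \<Rightarrow> 'c::second_countable_topology"
  assumes "adapted J X" "adapted J Y" "(\<lambda>p. h (fst p) (snd p)) \<in> borel_measurable borel"
  shows "adapted J (\<lambda>\<omega>. h (X \<omega>) (Y \<omega>))"
  using adapted_compose[OF adapted_Pair[OF assms(1,2)] assms(3)] by simp

lemma adapted_sum:
  fixes X :: "'i \<Rightarrow> 'w \<Rightarrow> 'b::euclidean_space"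
  assumes "J \<subseteq> I" "\<And>k. k \<in> A \<Longrightarrow> adapted J (X k)"
  shows "adapted J (\<lambda>\<omega>. \<Sum>k\<in>A. X k \<omega>)"
  using assms(2)
proof (induction A rule: infinite_finite_induct)
  case (insert k A)
  then have "adapted J (\<lambda>\<omega>. X k \<omega> + (\<Sum>k\<in>A. X k \<omega>))"
    by (intro adapted_compose2[of _ _ _ "(+)"] borel_measurable_continuous_onI)
      (auto intro!: continuous_intros)
  then show ?case using insert by simp
qed (auto intro: adapted_const[OF assms(1)])

text \<open>A function of the noise in \<open>J\<close> is independent of \<open>v i\<close>. The
  version \<open>X'\<close> is that function itself, measurable by construction and equal to
  \<open>X\<close> up to a null set; the product form of the joint law prepares for Fubini.\<close>

lemma adapted_indep:
  fixes X :: "'w \<Rightarrow> 'b::topological_space"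
  assumes X: "adapted J X" and i: "i \<in> I" "i \<notin> J"
  obtains X' where "AE \<omega> in M. X \<omega> = X' \<omega>" "X' \<in> borel_measurable M"
    "distr M borel X' \<Otimes>\<^sub>M distr M borel (v i) = distr M (borel \<Otimes>\<^sub>M borel) (\<lambda>\<omega>. (X' \<omega>, v i \<omega>))"
proof -
  obtain F where F [measurable]: "F \<in> borel_measurable (PiM J (\<lambda>_. borel))"
      and X_F: "AE \<omega> in M. X \<omega> = F (\<lambda>i\<in>J. v i \<omega>)"
    using X unfolding adapted_def by blast
  let ?R = "\<lambda>K \<omega>. \<lambda>k\<in>K. v k \<omega>" and ?B = "\<lambda>K. PiM K (\<lambda>_. borel :: 'a measure)"
  have "indep_var (?B J) (?R J) (?B {i}) (?R {i})"
    using X i indep by (intro indep_var_restrict[OF indep]) (auto simp: adapted_def)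
  then have R [measurable]: "?R J \<in> M \<rightarrow>\<^sub>M ?B J" "?R {i} \<in> M \<rightarrow>\<^sub>M ?B {i}"
    and prod: "distr M (?B J) (?R J) \<Otimes>\<^sub>M distr M (?B {i}) (?R {i})
      = distr M (?B J \<Otimes>\<^sub>M ?B {i}) (\<lambda>\<omega>. (?R J \<omega>, ?R {i} \<omega>))"
    by (auto simp: indep_var_distribution_eq)
  have proj [measurable]: "(\<lambda>f. f i) \<in> borel_measurable (?B {i})" by simp
  have vi: "distr M borel (v i) = distr (distr M (?B {i}) (?R {i})) borel (\<lambda>f. f i)"
    by (subst distr_distr) (auto simp: comp_def)
  have XF: "distr M borel (\<lambda>\<omega>. F (?R J \<omega>)) = distr (distr M (?B J) (?R J)) borel F"
    by (subst distr_distr) (auto simp: comp_def)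
  interpret V: prob_space "distr M borel (v i)"
    using i(1) by (intro prob_space_distr measurable_noise)
  have "distr M borel (\<lambda>\<omega>. F (?R J \<omega>)) \<Otimes>\<^sub>M distr M borel (v i)
      = distr (distr M (?B J) (?R J) \<Otimes>\<^sub>M distr M (?B {i}) (?R {i})) (borel \<Otimes>\<^sub>M borel)
          (\<lambda>(f, h). (F f, h i))"
    unfolding vi XF using V.sigma_finite_measure_axioms
    by (intro pair_measure_distr) (auto simp: vi)
  also have "\<dots> = distr M (borel \<Otimes>\<^sub>M borel) (\<lambda>\<omega>. (F (?R J \<omega>), v i \<omega>))"
    unfolding prod by (subst distr_distr) (auto simp: comp_def)
  finally show ?thesis
    using that[of "\<lambda>\<omega>. F (?R J \<omega>)"] X_F by simp
qed

text \<open>Fubini for null sets: \<open>X\<close> may be frozen while \<open>v i\<close> varies, as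
  the joint law is a product.\<close>

lemma AE_adapted_noise:
  fixes X :: "'w \<Rightarrow> 'b::second_countable_topology"
  assumes X: "adapted J X" and i: "i \<in> I" "i \<notin> J"
    and P: "Measurable.pred borel (\<lambda>p. P (fst p) (snd p))"
    and AE_P: "\<And>x. AE u in distr M borel (v i). P x u"
  shows "AE \<omega> in M. P (X \<omega>) (v i \<omega>)"
proof -
  obtain X' where X': "AE \<omega> in M. X \<omega> = X' \<omega>" "X' \<in> borel_measurable M"
    "distr M borel X' \<Otimes>\<^sub>M distr M borel (v i) = distr M (borel \<Otimes>\<^sub>M borel) (\<lambda>\<omega>. (X' \<omega>, v i \<omega>))"
    using adapted_indep[OF X i] .
  note [measurable] = X'(2) measurable_noise[OF i(1)]
  have P': "Measurable.pred (borel \<Otimes>\<^sub>M borel) (\<lambda>p. P (fst p) (snd p))"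
    using P by (simp add: borel_prod)
  interpret D1: prob_space "distr M borel X'" by (rule prob_space_distr) simp
  interpret D2: prob_space "distr M borel (v i)" by (rule prob_space_distr) simp
  interpret P: pair_prob_space "distr M borel X'" "distr M borel (v i)" ..
  have "AE p in distr M borel X' \<Otimes>\<^sub>M distr M borel (v i). P (fst p) (snd p)"
  proof (rule P.AE_pair_measure)
    show "{p \<in> space (distr M borel X' \<Otimes>\<^sub>M distr M borel (v i)). P (fst p) (snd p)}
        \<in> sets (distr M borel X' \<Otimes>\<^sub>M distr M borel (v i))"
      using P' by (simp add: pred_def space_pair_measure cong: sets_pair_measure_cong)
  qed (use AE_P in simp)
  then have "AE p in distr M (borel \<Otimes>\<^sub>M borel) (\<lambda>\<omega>. (X' \<omega>, v i \<omega>)). P (fst p) (snd p)"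
    by (simp only: X'(3))
  then have "AE \<omega> in M. P (X' \<omega>) (v i \<omega>)"
    using P' by (subst (asm) AE_distr_iff) (auto simp: pred_def)
  then show ?thesis using X'(1) by eventually_elim simp
qed

text \<open>By Fubini the expectation is an iterated integral whose inner part, over
  \<open>v i\<close> with \<open>X\<close> frozen, vanishes.\<close>

lemma expectation_adapted_noise:
  fixes X :: "'w \<Rightarrow> 'b::second_countable_topology" and \<phi> :: "'b \<Rightarrow> 'a \<Rightarrow> real"
  assumes X: "adapted J X" and i: "i \<in> I" "i \<notin> J"
    and \<phi>: "(\<lambda>p. \<phi> (fst p) (snd p)) \<in> borel_measurable borel"
    and bd: "\<And>x u. \<bar>\<phi> x u\<bar> \<le> C"
    and zero: "\<And>x. (\<integral>u. \<phi> x u \<partial>distr M borel (v i)) = 0"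
    and [measurable]: "X \<in> borel_measurable M"
  shows "expectation (\<lambda>\<omega>. \<phi> (X \<omega>) (v i \<omega>)) = 0"
proof -
  obtain X' where X': "AE \<omega> in M. X \<omega> = X' \<omega>" "X' \<in> borel_measurable M"
    "distr M borel X' \<Otimes>\<^sub>M distr M borel (v i) = distr M (borel \<Otimes>\<^sub>M borel) (\<lambda>\<omega>. (X' \<omega>, v i \<omega>))"
    using adapted_indep[OF X i] .
  note [measurable] = X'(2) measurable_noise[OF i(1)]
  have \<phi>' [measurable]: "(\<lambda>p. \<phi> (fst p) (snd p)) \<in> borel_measurable (borel \<Otimes>\<^sub>M borel)"
    using \<phi> by (simp add: borel_prod)
  have \<phi>'' [measurable]: "(\<lambda>\<omega>. \<phi> (Y \<omega>) (v i \<omega>)) \<in> borel_measurable M"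
    if "Y \<in> borel_measurable M" for Y
    using measurable_compose[OF measurable_Pair[OF that] \<phi>', of "v i"] by simp
  interpret D1: prob_space "distr M borel X'" by (rule prob_space_distr) simp
  interpret D2: prob_space "distr M borel (v i)" by (rule prob_space_distr) simp
  interpret D: pair_prob_space "distr M borel X'" "distr M borel (v i)" ..
  let ?P = "distr M borel X' \<Otimes>\<^sub>M distr M borel (v i)"
  have joint: "?P = distr M (borel \<Otimes>\<^sub>M borel) (\<lambda>\<omega>. (X' \<omega>, v i \<omega>))"
    by (simp only: X'(3))
  have "expectation (\<lambda>\<omega>. \<phi> (X \<omega>) (v i \<omega>)) = expectation (\<lambda>\<omega>. \<phi> (X' \<omega>) (v i \<omega>))"
    using X'(1) by (intro integral_cong_AE) auto
  also have "\<dots> = (\<integral>p. \<phi> (fst p) (snd p) \<partial>?P)"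
    unfolding joint by (subst integral_distr) auto
  also have "\<dots> = (\<integral>x. (\<integral>u. \<phi> x u \<partial>distr M borel (v i)) \<partial>distr M borel X')"
  proof -
    have "integrable ?P (\<lambda>p. \<phi> (fst p) (snd p))"
      using bd by (intro D.integrable_const_bound[where B=C]) auto
    then show ?thesis by (subst D.integral_fst'[symmetric]) auto
  qed
  also have "\<dots> = 0" by (simp add: zero)
  finally show ?thesis .
qed

end

subsection \<open>Gradients and blocks\<close>

text \<open>By convexity the difference quotients along the segment from \<open>x\<close> to
  \<open>y\<close> are at most \<open>f y - f x\<close>; letting the parameter tend to 0 from the
  right gives the claim. The segment stays in \<open>S\<close>, so the derivative within
  \<open>S\<close> suffices even if \<open>S\<close> has empty interior.\<close>

lemma convex_on_above_gradient:
  fixes f :: "'a::euclidean_space \<Rightarrow> real"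
  assumes f: "convex_on S f" and grad: "(f has_derivative (\<lambda>h. g \<bullet> h)) (at x within S)"
    and x: "x \<in> S" and y: "y \<in> S"
  shows "f x - f y \<le> g \<bullet> (x - y)"
proof -
  let ?\<gamma> = "\<lambda>s::real. x + s *\<^sub>R (y - x)"
  have \<gamma>: "?\<gamma> s = (1 - s) *\<^sub>R x + s *\<^sub>R y" for s by (simp add: algebra_simps)
  have img: "?\<gamma> ` {0<..<1} \<subseteq> S"
    unfolding \<gamma> using convex_on_imp_convex[OF f] x y by (auto simp: convex_alt)
  have "(?\<gamma> has_derivative (\<lambda>s. s *\<^sub>R (y - x))) (at 0 within {0<..<1})"
    by (auto intro!: derivative_eq_intros)
  then have "((\<lambda>s. f (?\<gamma> s)) has_derivative (\<lambda>s. g \<bullet> (s *\<^sub>R (y - x)))) (at 0 within {0<..<1})"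
    using has_derivative_in_compose[of ?\<gamma> "\<lambda>s. s *\<^sub>R (y - x)" 0 "{0<..<1}" f "(\<bullet>) g"]
      has_derivative_subset[OF grad img] by simp
  then have "((\<lambda>s. f (?\<gamma> s)) has_field_derivative g \<bullet> (y - x)) (at 0 within {0<..<1})"
    unfolding has_field_derivative_def inner_scaleR_right by (simp only: mult_commute_abs)
  then have lim: "((\<lambda>s. (f (?\<gamma> s) - f x) / s) \<longlongrightarrow> g \<bullet> (y - x)) (at 0 within {0<..<1})"
    by (simp add: has_field_derivative_iff)
  have "(f (?\<gamma> s) - f x) / s \<le> f y - f x" if s: "s \<in> {0<..<1}" for s
  proof -
    have "f (?\<gamma> s) \<le> (1 - s) * f x + s * f y"
      unfolding \<gamma> using convex_onD[OF f, of s x y] s x y by simp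
    then have "f (?\<gamma> s) - f x \<le> (f y - f x) * s"
      by (simp add: left_diff_distrib mult.commute[of s])
    then show ?thesis using s by (simp add: pos_divide_le_eq)
  qed
  then have "\<forall>\<^sub>F s in at 0 within {0<..<1}. (f (?\<gamma> s) - f x) / s \<le> f y - f x"
    by (auto simp: eventually_at_filter)
  moreover have "at (0::real) within {0<..<1} \<noteq> bot"
    by (simp add: trivial_limit_within islimpt_greaterThanLessThan1)
  ultimately have "g \<bullet> (y - x) \<le> f y - f x"
    using tendsto_upperbound[OF lim] by blast
  then show ?thesis by (simp add: inner_diff_right)
qed

section \<open>Block arithmetic\<close>

lemma block_of_eq:
  assumes "k \<in> {(m - 1) * K + 1..m * K}"
  shows "block_of K k = m"
proof -
  have m: "m \<ge> 1" and K: "K > 0" using assms by (cases m; cases K; auto)+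
  have "\<lceil>real k / real K\<rceil> = int m"
  proof (rule ceiling_unique)
    have "(m - 1) * K < k" using assms by simp
    then have "real ((m - 1) * K) < real k" by (simp only: of_nat_less_iff)
    then show "real_of_int (int m) - 1 < real k / real K"
      using m K by (simp add: pos_less_divide_eq of_nat_diff)
    have "real k \<le> real (m * K)" using assms by (simp only: of_nat_le_iff) simp
    then show "real k / real K \<le> real_of_int (int m)"
      using K by (simp add: pos_divide_le_eq)
  qed
  then show ?thesis by (simp add: block_of_def)
qed

lemma block_of_range:
  assumes "k \<in> {1..m * K}"
  shows "block_of K k \<in> {1..m}"
proof -
  have K: "K > 0" using assms by (cases K) auto
  have "0 < real k / real K" using assms K by simp
  then have "0 < \<lceil>real k / real K\<rceil>" by simp
  moreover have "real k \<le> real (m * K)" using assms by (simp only: of_nat_le_iff) simp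
  then have "\<lceil>real k / real K\<rceil> \<le> int m"
    using K by (simp add: ceiling_le_iff pos_divide_le_eq)
  ultimately show ?thesis by (auto simp: block_of_def nat_le_iff Suc_le_eq)
qed

lemma sum_blocks:
  fixes h :: "nat \<Rightarrow> 'b::comm_monoid_add"
  shows "(\<Sum>i=1..m. \<Sum>k=(i - 1) * K + 1..i * K. h k) = (\<Sum>k=1..m * K. h k)"
proof (induction m)
  case (Suc m)
  have "{1..Suc m * K} = {1..m * K} \<union> {m * K + 1..Suc m * K}" by auto
  then have "(\<Sum>k=1..Suc m * K. h k) = (\<Sum>k=1..m * K. h k) + (\<Sum>k=m * K + 1..Suc m * K. h k)"
    by (simp only:) (rule sum.union_disjoint; auto)
  then show ?case using Suc by simp
qed simp

section \<open>Gradients received and gradients still missing\<close>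

context
  fixes S :: "'a::euclidean_space set" and T K :: nat and \<delta> :: real and grad d v y x g
  assumes run: "delayed_ospf S T K \<delta> grad d v y x g"
    and delay: "\<And>t. t \<in> {1..T} \<Longrightarrow> d t \<ge> 1"
begin

lemma received_eq:
  assumes "t \<le> T"
  shows "g t = (\<Sum>k\<in>{k \<in> {1..T}. k + d k - 1 \<le> t}. grad k (x (block_of K k)))"
  using assms
proof (induction t)
  case 0
  \<comment> \<open>Rounds and delays are at least 1, so the earliest possible arrival is at the end
    of round 1.\<close>
  have e: "{k \<in> {1..T}. k + d k - 1 \<le> 0} = {}" using delay by fastforce
  show ?case using run unfolding e by (simp add: delayed_ospf_def)
next
  case (Suc t)
  have "{k \<in> {1..T}. k + d k - 1 \<le> Suc t}
      = {k \<in> {1..T}. k + d k - 1 \<le> t} \<union> arrivals T d (Suc t)"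
    by (auto simp: arrivals_def)
  moreover have "g (Suc t) = g t + (\<Sum>k\<in>arrivals T d (Suc t). grad k (x (block_of K k)))"
    using run Suc.prems unfolding delayed_ospf_def by auto
  ultimately show ?case using Suc
    by (simp only:) (subst sum.union_disjoint, auto simp: arrivals_def)
qed

text \<open>Everything received before block \<open>m\<close> stems from earlier blocks, and
  everything older than \<open>dmax\<close> rounds has arrived. What is missing up to the end of
  block \<open>m\<close> therefore lies in a window of at most \<open>K + dmax\<close>
  rounds.\<close>

lemma missing_gradients_le:
  assumes m: "m \<ge> 1" "m * K \<le> T" and dmax: "\<And>t. t \<in> {1..T} \<Longrightarrow> d t \<le> dmax"
    and G: "\<And>k. k \<in> {1..T} \<Longrightarrow> norm (grad k (x (block_of K k))) \<le> G" "0 \<le> G"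
  shows "norm (g ((m - 1) * K) - (\<Sum>i=1..m. \<Sum>k=(i - 1) * K + 1..i * K. grad k (x i)))
    \<le> G * (real K + real dmax)"
proof -
  let ?h = "\<lambda>k. grad k (x (block_of K k))"
  let ?A = "{k \<in> {1..T}. k + d k - 1 \<le> (m - 1) * K}"
  have mK: "m * K = (m - 1) * K + K" using m(1) by (simp add: algebra_simps flip: mult_Suc)
  have A: "?A \<subseteq> {1..m * K}"
  proof
    fix k assume k: "k \<in> ?A"
    then have "d k \<ge> 1" using delay by auto
    then show "k \<in> {1..m * K}" using k mK by auto
  qed
  have "(\<Sum>i=1..m. \<Sum>k=(i - 1) * K + 1..i * K. grad k (x i))
      = (\<Sum>i=1..m. \<Sum>k=(i - 1) * K + 1..i * K. ?h k)"
    by (intro sum.cong refl) (metis block_of_eq)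
  also have "\<dots> = (\<Sum>k=1..m * K. ?h k)" by (rule sum_blocks)
  also have "\<dots> = (\<Sum>k\<in>{1..m * K} - ?A. ?h k) + (\<Sum>k\<in>?A. ?h k)"
    by (rule sum.subset_diff[OF A]) simp
  finally have "g ((m - 1) * K) - (\<Sum>i=1..m. \<Sum>k=(i - 1) * K + 1..i * K. grad k (x i))
      = - (\<Sum>k\<in>{1..m * K} - ?A. ?h k)"
    using mK m received_eq[of "(m - 1) * K"] by simp
  then have "norm (g ((m - 1) * K) - (\<Sum>i=1..m. \<Sum>k=(i - 1) * K + 1..i * K. grad k (x i)))
      \<le> (\<Sum>k\<in>{1..m * K} - ?A. norm (?h k))"
    by (simp add: norm_sum)
  also have "\<dots> \<le> of_nat (card ({1..m * K} - ?A)) * G"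
    using m G(1) by (intro sum_bounded_above) auto
  also have "\<dots> \<le> real (K + dmax) * G"
  proof -
    \<comment> \<open>A missing round satisfies \<open>k + d k - 1 > (m - 1) * K\<close>, which with
      \<open>d k \<le> dmax\<close> gives the lower end. If the subtraction truncates, the lower end
      is 0 and imposes no restriction.\<close>
    have "{1..m * K} - ?A \<subseteq> {(m - 1) * K + 2 - dmax..m * K}"
    proof
      fix k assume k: "k \<in> {1..m * K} - ?A"
      then have "d k \<le> dmax" using dmax m by auto
      then show "k \<in> {(m - 1) * K + 2 - dmax..m * K}" using k m by auto
    qed
    then have "card ({1..m * K} - ?A) \<le> card {(m - 1) * K + 2 - dmax..m * K}"
      by (intro card_mono) auto
    also have "\<dots> \<le> K + dmax" using mK by simp
    finally show ?thesis using G(2) by (intro mult_right_mono) (simp_all only: of_nat_le_iff)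
  qed
  finally show ?thesis by (simp add: mult.commute)
qed

end

subsection \<open>Delayed OSPF\<close>

text \<open>Block size, number of blocks and \<open>\<delta>\<close> stay free here, and
  \<open>dmax\<close> is any upper bound on the delays. The choice of parameters enters only in the
  final theorem.\<close>

locale delayed_ospf_run = bounded_domain S D + independent_noise M v "{1..T}"
  for S :: "'a::euclidean_space set" and D :: real
    and M :: "'w measure" and v :: "nat \<Rightarrow> 'w \<Rightarrow> 'a" and T :: nat +
  fixes K N dmax :: nat and \<delta> G \<alpha> :: real
    and grad :: "nat \<Rightarrow> 'a \<Rightarrow> 'a" and d :: "nat \<Rightarrow> nat"
    and y :: "nat \<Rightarrow> nat \<Rightarrow> 'w \<Rightarrow> 'a" and x g :: "nat \<Rightarrow> 'w \<Rightarrow> 'a"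
  assumes K_pos: "K > 0" and T_eq: "T = N * K" and \<delta>_pos: "\<delta> > 0" and G_nonneg: "G \<ge> 0"
    and grad_lipschitz: "\<And>t. t \<in> {1..T} \<Longrightarrow> \<alpha>-lipschitz_on S (grad t)"
    and grad_bound: "\<And>t a. t \<in> {1..T} \<Longrightarrow> a \<in> S \<Longrightarrow> norm (grad t a) \<le> G"
    and delay: "\<And>t. t \<in> {1..T} \<Longrightarrow> 1 \<le> d t" "\<And>t. t \<in> {1..T} \<Longrightarrow> d t \<le> dmax"
    and noise: "\<And>i. i \<in> {1..T} \<Longrightarrow> distr M borel (v i) = unif_ball"
    and y_measurable: "\<And>m j. m \<in> {1..N} \<Longrightarrow> j \<in> {1..K} \<Longrightarrow> y m j \<in> borel_measurable M"
    and run: "\<And>\<omega>. \<omega> \<in> space M \<Longrightarrow>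
      delayed_ospf S T K \<delta> grad d (\<lambda>i. v i \<omega>) (\<lambda>m j. y m j \<omega>) (\<lambda>m. x m \<omega>) (\<lambda>t. g t \<omega>)"
begin

abbreviation received :: "nat \<Rightarrow> 'w \<Rightarrow> 'a" where
  "received m \<equiv> g ((m - 1) * K)"

abbreviation noise_index :: "nat \<Rightarrow> nat \<Rightarrow> nat" where
  "noise_index m j \<equiv> (m - 1) * K + j"

section \<open>Feasibility and measurability along a run\<close>

lemma block_end_le: "m \<in> {1..N} \<Longrightarrow> m * K \<le> T"
  unfolding T_eq by (rule mult_le_mono1) simp

lemma block_end_eq: "m \<in> {1..N} \<Longrightarrow> m * K = (m - 1) * K + K"
  by (cases m) auto

lemma noise_index_in:
  assumes "m \<in> {1..N}" "j \<in> {1..K}"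
  shows "noise_index m j \<in> {1..m * K}" "noise_index m j \<in> {1..T}"
    "noise_index m j \<notin> {1..(m - 1) * K}"
  using assms block_end_le[OF assms(1)] block_end_eq[OF assms(1)] by auto

lemma past_subset: "m \<in> {1..N} \<Longrightarrow> {1..(m - 1) * K} \<subseteq> {1..T}"
  using block_end_le[of m] block_end_eq[of m] by auto

lemma y_maximizer:
  assumes "\<omega> \<in> space M" "m \<in> {1..N}" "j \<in> {1..K}"
  shows "maximizer (- received m \<omega> + inverse \<delta> *\<^sub>R v (noise_index m j) \<omega>) (y m j \<omega>)"
proof -
  have "T div K = N" using K_pos by (simp add: T_eq)
  then show ?thesis using run[OF assms(1)] assms(2,3) unfolding delayed_ospf_def by auto
qed

lemma y_in: "\<omega> \<in> space M \<Longrightarrow> m \<in> {1..N} \<Longrightarrow> j \<in> {1..K} \<Longrightarrow> y m j \<omega> \<in> S"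
  using y_maximizer by (simp add: maximizer_iff)

lemma x_eq:
  assumes "\<omega> \<in> space M" "m \<in> {1..N}"
  shows "x m \<omega> = (1 / real K) *\<^sub>R (\<Sum>j=1..K. y m j \<omega>)"
proof -
  have "T div K = N" using K_pos by (simp add: T_eq)
  then show ?thesis using run[OF assms(1)] assms(2) unfolding delayed_ospf_def by auto
qed

lemma x_in:
  assumes "\<omega> \<in> space M" "m \<in> {1..N}"
  shows "x m \<omega> \<in> S"
proof -
  have "(\<Sum>j\<in>{1..K}. (1 / real K) *\<^sub>R y m j \<omega>) \<in> S"
    using assms K_pos by (intro convex_sum convex y_in) auto
  then show ?thesis using assms by (simp add: x_eq scaleR_sum_right)
qed

lemma x_measurable: "m \<in> {1..N} \<Longrightarrow> x m \<in> borel_measurable M"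
proof -
  assume m: "m \<in> {1..N}"
  have "(\<lambda>\<omega>. (1 / real K) *\<^sub>R (\<Sum>j=1..K. y m j \<omega>)) \<in> borel_measurable M"
    using y_measurable[OF m] by (intro borel_measurable_scaleR borel_measurable_sum) auto
  then show ?thesis by (subst measurable_cong[OF x_eq]) (use m in auto)
qed

text \<open>The gradients are only controlled on \<open>S\<close>; precomposing with the projection extends them to
  globally Lipschitz maps.\<close>

definition pgrad :: "nat \<Rightarrow> 'a \<Rightarrow> 'a" where
  "pgrad k z = grad k (closest_point S z)"

lemma proj_in: "closest_point S z \<in> S"
  using compact zero by (intro closest_point_in_set compact_imp_closed) auto

lemma pgrad_eq: "z \<in> S \<Longrightarrow> pgrad k z = grad k z"
  by (simp add: pgrad_def closest_point_self)

lemma norm_pgrad_le: "k \<in> {1..T} \<Longrightarrow> norm (pgrad k z) \<le> G"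
  unfolding pgrad_def by (intro grad_bound proj_in)

lemma pgrad_lipschitz:
  assumes "k \<in> {1..T}"
  shows "\<alpha>-lipschitz_on UNIV (pgrad k)"
proof -
  have "1-lipschitz_on UNIV (closest_point S)"
    using zero by (intro lipschitz_onI)
      (auto intro!: closest_point_lipschitz convex compact_imp_closed compact)
  moreover have "\<alpha>-lipschitz_on (closest_point S ` UNIV) (grad k)"
    using grad_lipschitz[OF assms] by (rule lipschitz_on_subset) (auto intro: proj_in)
  ultimately show ?thesis
    using lipschitz_on_compose2[of 1 UNIV "closest_point S" \<alpha> "grad k"]
    by (simp add: pgrad_def[abs_def])
qed

lemma pgrad_borel: "k \<in> {1..T} \<Longrightarrow> pgrad k \<in> borel_measurable borel"
  by (intro borel_measurable_continuous_onI lipschitz_on_continuous_on[OF pgrad_lipschitz])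

lemma received_eq_pgrad:
  assumes \<omega>: "\<omega> \<in> space M" and m: "m \<in> {1..N}"
  shows "received m \<omega> = (\<Sum>k\<in>{k \<in> {1..T}. k + d k - 1 \<le> (m - 1) * K}. pgrad k (x (block_of K k) \<omega>))"
proof -
  have "(m - 1) * K \<le> T" using block_end_le[OF m] block_end_eq[OF m] by simp
  moreover have "pgrad k (x (block_of K k) \<omega>) = grad k (x (block_of K k) \<omega>)" if "k \<in> {1..T}" for k
    using that \<omega> block_of_range[of k N K] by (intro pgrad_eq x_in) (auto simp: T_eq)
  ultimately show ?thesis
    using received_eq[OF run[OF \<omega>] delay(1)] by simp
qed

section \<open>Dependence of the decisions on the noise\<close>

lemma received_index:
  assumes "m \<in> {1..N}" "k \<in> {1..T}" "k + d k - 1 \<le> (m - 1) * K"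
  shows "block_of K k \<in> {1..m - 1}"
  using assms delay(1)[OF assms(2)] by (intro block_of_range) auto

lemma received_measurable:
  assumes m: "m \<in> {1..N}"
  shows "received m \<in> borel_measurable M"
proof -
  have "(\<lambda>\<omega>. \<Sum>k\<in>{k \<in> {1..T}. k + d k - 1 \<le> (m - 1) * K}. pgrad k (x (block_of K k) \<omega>))
      \<in> borel_measurable M"
  proof (intro borel_measurable_sum)
    fix k assume k: "k \<in> {k \<in> {1..T}. k + d k - 1 \<le> (m - 1) * K}"
    then have "block_of K k \<in> {1..N}" using received_index[OF m, of k] m by auto
    then show "(\<lambda>\<omega>. pgrad k (x (block_of K k) \<omega>)) \<in> borel_measurable M"
      using k by (intro measurable_compose[OF x_measurable pgrad_borel]) auto
  qed
  then show ?thesis by (subst measurable_cong[OF received_eq_pgrad]) (use m in auto)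
qed

text \<open>Delays of at least 1 ensure that gradients available at the start of block
  \<open>m\<close> were taken in strictly earlier blocks. The assumption on these blocks is
  discharged by the induction in \<open>x_adapted\<close>.\<close>

lemma received_adapted_if:
  assumes m: "m \<in> {1..N}" and past: "\<And>i. i \<in> {1..m - 1} \<Longrightarrow> adapted {1..i * K} (x i)"
  shows "adapted {1..(m - 1) * K} (received m)"
proof (rule adapted_cong_AE)
  show "adapted {1..(m - 1) * K}
      (\<lambda>\<omega>. \<Sum>k\<in>{k \<in> {1..T}. k + d k - 1 \<le> (m - 1) * K}. pgrad k (x (block_of K k) \<omega>))"
  proof (rule adapted_sum[OF past_subset[OF m]])
    fix k assume k: "k \<in> {k \<in> {1..T}. k + d k - 1 \<le> (m - 1) * K}"
    then have b: "block_of K k \<in> {1..m - 1}" using received_index[OF m, of k] by auto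
    then have "block_of K k * K \<le> (m - 1) * K" by (intro mult_le_mono1) auto
    then have "adapted {1..(m - 1) * K} (x (block_of K k))"
      by (intro adapted_mono[OF past[OF b]] past_subset[OF m]) auto
    then show "adapted {1..(m - 1) * K} (\<lambda>\<omega>. pgrad k (x (block_of K k) \<omega>))"
      by (rule adapted_compose) (use k in \<open>auto intro: pgrad_borel\<close>)
  qed
  show "AE \<omega> in M. received m \<omega> =
      (\<Sum>k\<in>{k \<in> {1..T}. k + d k - 1 \<le> (m - 1) * K}. pgrad k (x (block_of K k) \<omega>))"
    using received_eq_pgrad[OF _ m] by (intro AE_I2)
qed

text \<open>The received gradients depend only on noise from before the block, hence are independent
  of the perturbation used here. With them frozen, \<open>AE_unique_at\<close> gives uniqueness
  almost surely, which makes the breaking of ties irrelevant.\<close>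

lemma y_eq_selection_if:
  assumes m: "m \<in> {1..N}" and j: "j \<in> {1..K}"
    and rec: "adapted {1..(m - 1) * K} (received m)"
  shows "AE \<omega> in M. y m j \<omega> = selection (- received m \<omega> + inverse \<delta> *\<^sub>R v (noise_index m j) \<omega>)"
proof -
  have "AE \<omega> in M. unique_at (- received m \<omega> + inverse \<delta> *\<^sub>R v (noise_index m j) \<omega>)"
  proof (rule AE_adapted_noise[OF rec noise_index_in(2,3)[OF m j]])
    have [measurable]: "(\<lambda>p::'a \<times> 'a. - fst p + inverse \<delta> *\<^sub>R snd p) \<in> borel_measurable borel"
      by (intro borel_measurable_continuous_onI continuous_intros)
    show "Measurable.pred borel (\<lambda>p::'a \<times> 'a. unique_at (- fst p + inverse \<delta> *\<^sub>R snd p))"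
      by measurable
    show "AE u in distr M borel (v (noise_index m j)). unique_at (- z + inverse \<delta> *\<^sub>R u)" for z
      unfolding noise[OF noise_index_in(2)[OF m j]] using \<delta>_pos by (intro AE_unique_at) simp
  qed
  with AE_space show ?thesis
  proof eventually_elim
    case (elim \<omega>)
    then show ?case using selection_eq y_maximizer[OF _ m j] by metis
  qed
qed

lemma x_adapted_if:
  assumes m: "m \<in> {1..N}" and rec: "adapted {1..(m - 1) * K} (received m)"
  shows "adapted {1..m * K} (x m)"
proof (rule adapted_cong_AE)
  have sub: "{1..m * K} \<subseteq> {1..T}" using block_end_le[OF m] by auto
  have "adapted {1..m * K} (y m j)" if j: "j \<in> {1..K}" for j
  proof (rule adapted_cong_AE[OF _ y_eq_selection_if[OF m j rec]])
    have "(\<lambda>p::'a \<times> 'a. - fst p + inverse \<delta> *\<^sub>R snd p) \<in> borel_measurable borel"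
      by (intro borel_measurable_continuous_onI continuous_intros)
    then have "(\<lambda>p::'a \<times> 'a. selection (- fst p + inverse \<delta> *\<^sub>R snd p)) \<in> borel_measurable borel"
      by measurable
    moreover have "adapted {1..m * K} (received m)"
      using block_end_eq[OF m] by (intro adapted_mono[OF rec _ sub]) auto
    ultimately show "adapted {1..m * K}
        (\<lambda>\<omega>. selection (- received m \<omega> + inverse \<delta> *\<^sub>R v (noise_index m j) \<omega>))"
      using noise_index_in(1)[OF m j] sub
      by (intro adapted_compose2[where h="\<lambda>a b. selection (- a + inverse \<delta> *\<^sub>R b)"] adapted_noise)
  qed
  then show "adapted {1..m * K} (\<lambda>\<omega>. (1 / real K) *\<^sub>R (\<Sum>j=1..K. y m j \<omega>))"
    by (intro adapted_compose[where h="\<lambda>z. (1 / real K) *\<^sub>R z"] adapted_sum[OF sub]) auto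
  show "AE \<omega> in M. x m \<omega> = (1 / real K) *\<^sub>R (\<Sum>j=1..K. y m j \<omega>)"
    using x_eq[OF _ m] by (intro AE_I2)
qed

text \<open>Induction over all earlier blocks: their decisions determine the received gradients, and
  these together with the noise of block \<open>m\<close> determine its decision almost
  surely.\<close>

lemma x_adapted: "m \<in> {1..N} \<Longrightarrow> adapted {1..m * K} (x m)"
proof (induction m rule: less_induct)
  case (less m)
  have "adapted {1..i * K} (x i)" if "i \<in> {1..m - 1}" for i
    using that less.prems by (intro less.IH) auto
  then show ?case by (intro x_adapted_if[OF less.prems received_adapted_if[OF less.prems]])
qed

lemma received_adapted: "m \<in> {1..N} \<Longrightarrow> adapted {1..(m - 1) * K} (received m)"
  by (rule received_adapted_if, assumption, rule x_adapted) auto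

lemmas y_eq_selection = y_eq_selection_if[OF _ _ received_adapted]

text \<open>The common conditional mean of the maximizers of block \<open>m\<close>, given the noise
  of the earlier blocks.\<close>

definition target :: "nat \<Rightarrow> 'w \<Rightarrow> 'a" where
  "target m \<omega> = mean_decision (inverse \<delta>) (received m \<omega>)"

lemma target_borel: "mean_decision (inverse \<delta>) \<in> borel_measurable borel"
  using \<delta>_pos by (intro mean_decision_borel) simp

lemma target_measurable: "m \<in> {1..N} \<Longrightarrow> target m \<in> borel_measurable M"
  unfolding target_def[abs_def] using received_measurable target_borel by (rule measurable_compose)

lemma norm_dev_le: "\<omega> \<in> space M \<Longrightarrow> m \<in> {1..N} \<Longrightarrow> j \<in> {1..K} \<Longrightarrow> norm (y m j \<omega> - target m \<omega>) \<le> 2 * D"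
  using norm_triangle_ineq4[of "y m j \<omega>" "target m \<omega>"] norm_le[OF y_in, of \<omega> m j]
    norm_mean_decision_le[of "inverse \<delta>" "received m \<omega>"]
  by (simp add: target_def)

text \<open>Conditionally on everything but its own perturbation, a maximizer has mean \<open>target\<close>.\<close>

lemma expectation_dev_eq_0:
  fixes Z :: "'w \<Rightarrow> 'a"
  assumes m: "m \<in> {1..N}" and j: "j \<in> {1..K}"
    and J: "{1..(m - 1) * K} \<subseteq> J" "J \<subseteq> {1..T}" "noise_index m j \<notin> J"
    and Z: "adapted J Z" "Z \<in> borel_measurable M"
    and c: "(\<lambda>p. c (fst p) (snd p)) \<in> borel_measurable borel" and C: "\<And>a b. norm (c a b) \<le> C"
  shows "expectation (\<lambda>\<omega>. c (Z \<omega>) (received m \<omega>) \<bullet> (y m j \<omega> - target m \<omega>)) = 0"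
proof -
  let ?r = "inverse \<delta>"
  \<comment> \<open>The pair \<open>p\<close> collects \<open>Z\<close> and the received gradients.
    With \<open>p\<close> frozen, \<open>\<phi> p\<close> is linear in a centred variable and
    integrates to 0 over the remaining perturbation.\<close>
  define \<phi> where "\<phi> p u = c (fst p) (snd p) \<bullet> (selection (- snd p + ?r *\<^sub>R u) - mean_decision ?r (snd p))"
    for p :: "'a \<times> 'a" and u
  note [measurable] = received_measurable[OF m] target_measurable[OF m] y_measurable[OF m j] Z(2)
    target_borel measurable_noise[OF noise_index_in(2)[OF m j]]
  have c' [measurable]: "(\<lambda>p. c (fst p) (snd p)) \<in> borel_measurable (borel \<Otimes>\<^sub>M borel)"
    using c by (simp add: borel_prod)
  have \<phi>_meas: "(\<lambda>p. \<phi> (fst p) (snd p)) \<in> borel_measurable borel"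
    unfolding \<phi>_def borel_prod[symmetric] by measurable
  have X: "adapted J (\<lambda>\<omega>. (Z \<omega>, received m \<omega>))"
    by (intro adapted_Pair Z adapted_mono[OF received_adapted[OF m] J(1,2)])
  have X_meas: "(\<lambda>\<omega>. (Z \<omega>, received m \<omega>)) \<in> borel_measurable M" by measurable
  have "\<bar>\<phi> p u\<bar> \<le> C * (2 * D)" for p u
  proof -
    have "norm (selection (- snd p + ?r *\<^sub>R u) - mean_decision ?r (snd p)) \<le> 2 * D"
      using norm_triangle_ineq4[of "selection (- snd p + ?r *\<^sub>R u)" "mean_decision ?r (snd p)"]
        norm_selection_le[of "- snd p + ?r *\<^sub>R u"] norm_mean_decision_le[of ?r "snd p"] by simp
    then show ?thesis
      unfolding \<phi>_def using C[of "fst p" "snd p"] order_trans[OF norm_ge_zero C]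
      by (intro order_trans[OF Cauchy_Schwarz_ineq2] mult_mono) auto
  qed
  moreover have "(\<integral>u. \<phi> p u \<partial>distr M borel (v (noise_index m j))) = 0" for p
  proof -
    interpret P: prob_space "unif_ball :: 'a measure" by (rule prob_space_unif_ball)
    have "(\<integral>u. \<phi> p u \<partial>unif_ball) = c (fst p) (snd p) \<bullet>
        (\<integral>u. selection (- snd p + ?r *\<^sub>R u) - mean_decision ?r (snd p) \<partial>unif_ball)"
      unfolding \<phi>_def
      by (rule integral_inner_right) (intro Bochner_Integration.integrable_diff integrable_selection, simp)
    also have "(\<integral>u. selection (- snd p + ?r *\<^sub>R u) - mean_decision ?r (snd p) \<partial>unif_ball) = 0"
      by (subst Bochner_Integration.integral_diff[OF integrable_selection])
        (use P.prob_space in \<open>simp_all add: mean_decision_def\<close>)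
    finally show ?thesis unfolding noise[OF noise_index_in(2)[OF m j]] by simp
  qed
  ultimately have "expectation (\<lambda>\<omega>. \<phi> (Z \<omega>, received m \<omega>) (v (noise_index m j) \<omega>)) = 0"
    using X_meas by (intro expectation_adapted_noise[OF X noise_index_in(2)[OF m j] J(3) \<phi>_meas]) auto
  moreover have "expectation (\<lambda>\<omega>. c (Z \<omega>) (received m \<omega>) \<bullet> (y m j \<omega> - target m \<omega>))
      = expectation (\<lambda>\<omega>. \<phi> (Z \<omega>, received m \<omega>) (v (noise_index m j) \<omega>))"
  proof (rule integral_cong_AE)
    have "AE \<omega> in M. y m j \<omega> = selection (- received m \<omega> + ?r *\<^sub>R v (noise_index m j) \<omega>)"
      by (rule y_eq_selection[OF m j m])
    then show "AE \<omega> in M. c (Z \<omega>) (received m \<omega>) \<bullet> (y m j \<omega> - target m \<omega>)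
        = \<phi> (Z \<omega>, received m \<omega>) (v (noise_index m j) \<omega>)"
      by eventually_elim (simp add: \<phi>_def target_def)
    have [measurable]: "(\<lambda>\<omega>. c (Z \<omega>) (received m \<omega>)) \<in> borel_measurable M"
      using measurable_compose[OF measurable_Pair[OF Z(2) received_measurable[OF m]] c'] by simp
    show "(\<lambda>\<omega>. c (Z \<omega>) (received m \<omega>) \<bullet> (y m j \<omega> - target m \<omega>)) \<in> borel_measurable M"
      by measurable
    show "(\<lambda>\<omega>. \<phi> (Z \<omega>, received m \<omega>) (v (noise_index m j) \<omega>)) \<in> borel_measurable M"
      unfolding \<phi>_def by measurable
  qed
  ultimately show ?thesis by simp
qed

section \<open>Second moment of the deviation\<close>

lemma integrable_inner_bounded:
  fixes A B :: "'w \<Rightarrow> 'a"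
  assumes "A \<in> borel_measurable M" "B \<in> borel_measurable M"
    and "\<And>\<omega>. \<omega> \<in> space M \<Longrightarrow> norm (A \<omega>) \<le> a" "\<And>\<omega>. \<omega> \<in> space M \<Longrightarrow> norm (B \<omega>) \<le> b"
  shows "integrable M (\<lambda>\<omega>. A \<omega> \<bullet> B \<omega>)"
proof (rule integrable_const_bound[where B="a * b"])
  show "AE \<omega> in M. norm (A \<omega> \<bullet> B \<omega>) \<le> a * b"
  proof (rule AE_I2)
    fix \<omega> assume \<omega>: "\<omega> \<in> space M"
    show "norm (A \<omega> \<bullet> B \<omega>) \<le> a * b"
      using assms(3,4)[OF \<omega>] order_trans[OF norm_ge_zero assms(3)[OF \<omega>]]
      by (auto intro!: order_trans[OF Cauchy_Schwarz_ineq2] mult_mono)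
  qed
qed (use assms in measurable)

text \<open>Adding the perturbation of \<open>y m l\<close> to the past makes the
  \<open>l\<close>-th deviation an admissible weight in \<open>expectation_dev_eq_0\<close>, while
  the perturbation of \<open>y m j\<close> remains fresh.\<close>

lemma expectation_dev_dev_eq_0:
  assumes m: "m \<in> {1..N}" and j: "j \<in> {1..K}" and l: "l \<in> {1..K}" and ne: "l \<noteq> j"
  shows "expectation (\<lambda>\<omega>. (y m l \<omega> - target m \<omega>) \<bullet> (y m j \<omega> - target m \<omega>)) = 0"
proof -
  let ?r = "inverse \<delta>"
  define J where "J = insert (noise_index m l) {1..(m - 1) * K}"
  have J: "{1..(m - 1) * K} \<subseteq> J" "J \<subseteq> {1..T}" "noise_index m j \<notin> J"
    using noise_index_in[OF m j] noise_index_in[OF m l] past_subset[OF m] ne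
    by (auto simp: J_def)
  have "adapted J (y m l)"
  proof (rule adapted_cong_AE[OF _ y_eq_selection[OF m l m]])
    have "(\<lambda>p::'a \<times> 'a. - fst p + ?r *\<^sub>R snd p) \<in> borel_measurable borel"
      by (intro borel_measurable_continuous_onI continuous_intros)
    then have "(\<lambda>p::'a \<times> 'a. selection (- fst p + ?r *\<^sub>R snd p)) \<in> borel_measurable borel"
      by measurable
    moreover have "noise_index m l \<in> J" by (simp add: J_def)
    ultimately show "adapted J (\<lambda>\<omega>. selection (- received m \<omega> + ?r *\<^sub>R v (noise_index m l) \<omega>))"
      using adapted_mono[OF received_adapted[OF m] J(1,2)] J(2)
      by (intro adapted_compose2[where h="\<lambda>a b. selection (- a + ?r *\<^sub>R b)"] adapted_noise)
  qed
  \<comment> \<open>The projection leaves \<open>y m l\<close> unchanged and makes the weight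
    bounded for all arguments.\<close>
  moreover have "(\<lambda>p::'a \<times> 'a. closest_point S (fst p) - mean_decision ?r (snd p)) \<in> borel_measurable borel"
  proof -
    note [measurable] = target_borel
    have [measurable]: "closest_point S \<in> borel_measurable borel"
      using zero by (intro borel_measurable_continuous_onI continuous_on_closest_point
          convex compact_imp_closed[OF compact]) auto
    show ?thesis unfolding borel_prod[symmetric] by measurable
  qed
  moreover have "norm (closest_point S a - mean_decision ?r b) \<le> 2 * D" for a b
    using norm_triangle_ineq4[of "closest_point S a" "mean_decision ?r b"]
      norm_le[OF proj_in, of a] norm_mean_decision_le[of ?r b] by simp
  ultimately have "expectation (\<lambda>\<omega>. (closest_point S (y m l \<omega>) - mean_decision ?r (received m \<omega>))
      \<bullet> (y m j \<omega> - target m \<omega>)) = 0"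
    by (intro expectation_dev_eq_0[OF m j J, where c="\<lambda>a b. closest_point S a - mean_decision ?r b"]
        y_measurable[OF m l])
  then show ?thesis
    using y_in[OF _ m l] by (simp add: target_def closest_point_self cong: Bochner_Integration.integral_cong)
qed

lemma x_minus_target:
  assumes "\<omega> \<in> space M" "m \<in> {1..N}"
  shows "x m \<omega> - target m \<omega> = (1 / real K) *\<^sub>R (\<Sum>j=1..K. y m j \<omega> - target m \<omega>)"
  using K_pos by (simp add: x_eq[OF assms] sum_subtractf scaleR_diff_right sum_constant_scaleR)

lemma norm_x_dev_le:
  assumes "\<omega> \<in> space M" "m \<in> {1..N}"
  shows "norm (x m \<omega> - target m \<omega>) \<le> 2 * D"
  using norm_triangle_ineq4[of "x m \<omega>" "target m \<omega>"] norm_le[OF x_in[OF assms]]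
    norm_mean_decision_le[of "inverse \<delta>" "received m \<omega>"]
  by (simp add: target_def)

lemma integrable_dev_dev:
  assumes "m \<in> {1..N}" "j \<in> {1..K}" "l \<in> {1..K}"
  shows "integrable M (\<lambda>\<omega>. (y m l \<omega> - target m \<omega>) \<bullet> (y m j \<omega> - target m \<omega>))"
  using assms by (intro integrable_inner_bounded[where a="2 * D" and b="2 * D"] norm_dev_le
      borel_measurable_diff y_measurable target_measurable)

text \<open>In the expanded square of the average the mixed terms vanish. The \<open>K\<close>
  diagonal terms are at most \<open>(2 * D)\<^sup>2\<close> each and carry the factor
  \<open>1 / K\<^sup>2\<close>.\<close>

lemma expectation_sq_dev_le:
  assumes m: "m \<in> {1..N}"
  shows "expectation (\<lambda>\<omega>. (norm (x m \<omega> - target m \<omega>))\<^sup>2) \<le> 4 * D\<^sup>2 / K"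
proof -
  let ?e = "\<lambda>j \<omega>. y m j \<omega> - target m \<omega>"
  have "(norm (x m \<omega> - target m \<omega>))\<^sup>2 = (\<Sum>j=1..K. \<Sum>l=1..K. ?e l \<omega> \<bullet> ?e j \<omega>) / (real K)\<^sup>2"
    if "\<omega> \<in> space M" for \<omega>
  proof -
    have "(norm (x m \<omega> - target m \<omega>))\<^sup>2 = ((\<Sum>l=1..K. ?e l \<omega>) \<bullet> (\<Sum>j=1..K. ?e j \<omega>)) / (real K)\<^sup>2"
      unfolding x_minus_target[OF that m] power2_norm_eq_inner[symmetric]
      by (simp add: power_divide)
    also have "(\<Sum>l=1..K. ?e l \<omega>) \<bullet> (\<Sum>j=1..K. ?e j \<omega>) = (\<Sum>j=1..K. \<Sum>l=1..K. ?e l \<omega> \<bullet> ?e j \<omega>)"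
      by (subst inner_sum_right) (simp only: inner_sum_left)
    finally show ?thesis .
  qed
  then have "expectation (\<lambda>\<omega>. (norm (x m \<omega> - target m \<omega>))\<^sup>2)
      = expectation (\<lambda>\<omega>. (\<Sum>j=1..K. \<Sum>l=1..K. ?e l \<omega> \<bullet> ?e j \<omega>) / (real K)\<^sup>2)"
    by (intro Bochner_Integration.integral_cong) auto
  also have "\<dots> = (\<Sum>j=1..K. \<Sum>l=1..K. expectation (\<lambda>\<omega>. ?e l \<omega> \<bullet> ?e j \<omega>)) / (real K)\<^sup>2"
  proof -
    have "expectation (\<lambda>\<omega>. \<Sum>j=1..K. \<Sum>l=1..K. ?e l \<omega> \<bullet> ?e j \<omega>)
        = (\<Sum>j=1..K. \<Sum>l=1..K. expectation (\<lambda>\<omega>. ?e l \<omega> \<bullet> ?e j \<omega>))"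
      using integrable_dev_dev[OF m]
      by (subst Bochner_Integration.integral_sum, (intro Bochner_Integration.integrable_sum; simp),
          intro sum.cong refl Bochner_Integration.integral_sum) simp
    then show ?thesis by simp
  qed
  also have "\<dots> \<le> (\<Sum>j=1..K. 4 * D\<^sup>2) / (real K)\<^sup>2"
  proof (intro divide_right_mono sum_mono)
    fix j assume j: "j \<in> {1..K}"
    have "(\<Sum>l=1..K. expectation (\<lambda>\<omega>. ?e l \<omega> \<bullet> ?e j \<omega>)) = expectation (\<lambda>\<omega>. ?e j \<omega> \<bullet> ?e j \<omega>)"
      using expectation_dev_dev_eq_0[OF m j] j by (subst sum.remove[of _ j]) auto
    also have "\<dots> \<le> 4 * D\<^sup>2"
    proof (intro integral_le_const integrable_dev_dev m j AE_I2)
      fix \<omega> assume \<omega>: "\<omega> \<in> space M"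
      show "?e j \<omega> \<bullet> ?e j \<omega> \<le> 4 * D\<^sup>2"
        using power_mono[OF norm_dev_le[OF \<omega> m j], of 2]
        by (simp add: power2_norm_eq_inner power_mult_distrib)
    qed
    finally show "(\<Sum>l=1..K. expectation (\<lambda>\<omega>. ?e l \<omega> \<bullet> ?e j \<omega>)) \<le> 4 * D\<^sup>2" .
  qed simp
  also have "\<dots> = 4 * D\<^sup>2 / K" using K_pos by (simp add: power2_eq_square)
  finally show ?thesis .
qed

section \<open>Cost of replacing a decision by its conditional mean\<close>

lemma pgrad_x_measurable:
  "m \<in> {1..N} \<Longrightarrow> t \<in> {1..T} \<Longrightarrow> (\<lambda>\<omega>. pgrad t (x m \<omega>)) \<in> borel_measurable M"
  by (rule measurable_compose[OF x_measurable pgrad_borel])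

lemma pgrad_target_measurable:
  "m \<in> {1..N} \<Longrightarrow> t \<in> {1..T} \<Longrightarrow> (\<lambda>\<omega>. pgrad t (target m \<omega>)) \<in> borel_measurable M"
  by (rule measurable_compose[OF target_measurable pgrad_borel])

text \<open>The gradient at \<open>target m\<close> is a function of the received gradients alone,
  so it is a weight for \<open>expectation_dev_eq_0\<close> against each maximizer of the
  block.\<close>

lemma expectation_pgrad_target_dev_eq_0:
  assumes m: "m \<in> {1..N}" and t: "t \<in> {1..T}"
  shows "expectation (\<lambda>\<omega>. pgrad t (target m \<omega>) \<bullet> (x m \<omega> - target m \<omega>)) = 0"
proof -
  let ?r = "inverse \<delta>"
  have j0: "expectation (\<lambda>\<omega>. pgrad t (target m \<omega>) \<bullet> (y m j \<omega> - target m \<omega>)) = 0"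
    if j: "j \<in> {1..K}" for j
  proof -
    have "(\<lambda>p::'a \<times> 'a. pgrad t (mean_decision ?r (snd p))) \<in> borel_measurable borel"
    proof -
      note [measurable] = target_borel pgrad_borel[OF t]
      show ?thesis unfolding borel_prod[symmetric] by measurable
    qed
    then show ?thesis
      unfolding target_def
      using expectation_dev_eq_0[OF m j order_refl past_subset[OF m] noise_index_in(3)[OF m j]
          received_adapted[OF m] received_measurable[OF m], of "\<lambda>_ b. pgrad t (mean_decision ?r b)" G]
        norm_pgrad_le[OF t]
      by (simp add: target_def)
  qed
  have int: "integrable M (\<lambda>\<omega>. pgrad t (target m \<omega>) \<bullet> (y m j \<omega> - target m \<omega>))" if "j \<in> {1..K}" for j
    using that m t
    by (intro integrable_inner_bounded[where a=G and b="2 * D"] norm_dev_le norm_pgrad_le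
        borel_measurable_diff y_measurable target_measurable pgrad_target_measurable)
  have "expectation (\<lambda>\<omega>. pgrad t (target m \<omega>) \<bullet> (x m \<omega> - target m \<omega>))
      = expectation (\<lambda>\<omega>. (1 / real K) * (\<Sum>j=1..K. pgrad t (target m \<omega>) \<bullet> (y m j \<omega> - target m \<omega>)))"
    by (intro Bochner_Integration.integral_cong refl)
      (simp add: x_minus_target[OF _ m] inner_sum_right)
  also have "\<dots> = (1 / real K) * (\<Sum>j=1..K. expectation (\<lambda>\<omega>. pgrad t (target m \<omega>) \<bullet> (y m j \<omega> - target m \<omega>)))"
    using int by (subst integral_mult_right_zero, subst Bochner_Integration.integral_sum) auto
  also have "\<dots> = 0" using j0 by simp
  finally show ?thesis .
qed

lemma integrable_pgrad_dev:
  assumes "m \<in> {1..N}" "t \<in> {1..T}"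
  shows "integrable M (\<lambda>\<omega>. pgrad t (x m \<omega>) \<bullet> (x m \<omega> - target m \<omega>))"
    and "integrable M (\<lambda>\<omega>. pgrad t (target m \<omega>) \<bullet> (x m \<omega> - target m \<omega>))"
proof -
  note intros = integrable_inner_bounded[where a=G and b="2 * D"] norm_x_dev_le norm_pgrad_le
    borel_measurable_diff x_measurable target_measurable pgrad_target_measurable pgrad_x_measurable
  show "integrable M (\<lambda>\<omega>. pgrad t (x m \<omega>) \<bullet> (x m \<omega> - target m \<omega>))"
    using assms by (intro intros)
  show "integrable M (\<lambda>\<omega>. pgrad t (target m \<omega>) \<bullet> (x m \<omega> - target m \<omega>))"
    using assms by (intro intros)
qed

text \<open>The gradient at \<open>x m\<close> may be replaced by the one at \<open>target m\<close>, which is uncorrelated with the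
  deviation; by smoothness the error is at most \<open>\<alpha>\<close> times the squared deviation.\<close>

lemma expectation_pgrad_dev_le:
  assumes m: "m \<in> {1..N}" and t: "t \<in> {1..T}"
  shows "expectation (\<lambda>\<omega>. pgrad t (x m \<omega>) \<bullet> (x m \<omega> - target m \<omega>)) \<le> \<alpha> * (4 * D\<^sup>2 / K)"
proof -
  have \<alpha>: "0 \<le> \<alpha>" using grad_lipschitz[OF t] by (rule lipschitz_on_nonneg)
  let ?e = "\<lambda>\<omega>. x m \<omega> - target m \<omega>"
  have "expectation (\<lambda>\<omega>. pgrad t (x m \<omega>) \<bullet> ?e \<omega>)
      = expectation (\<lambda>\<omega>. pgrad t (x m \<omega>) \<bullet> ?e \<omega> - pgrad t (target m \<omega>) \<bullet> ?e \<omega>)"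
    using integrable_pgrad_dev[OF m t] expectation_pgrad_target_dev_eq_0[OF m t] by simp
  also have "\<dots> \<le> expectation (\<lambda>\<omega>. \<alpha> * (norm (?e \<omega>))\<^sup>2)"
  proof (rule integral_mono)
    show "integrable M (\<lambda>\<omega>. \<alpha> * (norm (?e \<omega>))\<^sup>2)"
      using m unfolding power2_norm_eq_inner
      by (intro integrable_mult_right integrable_inner_bounded[where a="2 * D" and b="2 * D"] norm_x_dev_le
          borel_measurable_diff x_measurable target_measurable)
    fix \<omega> assume "\<omega> \<in> space M"
    have "pgrad t (x m \<omega>) \<bullet> ?e \<omega> - pgrad t (target m \<omega>) \<bullet> ?e \<omega>
        = (pgrad t (x m \<omega>) - pgrad t (target m \<omega>)) \<bullet> ?e \<omega>"
      by (simp add: inner_diff_left)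
    also have "\<dots> \<le> norm (pgrad t (x m \<omega>) - pgrad t (target m \<omega>)) * norm (?e \<omega>)"
      by (rule norm_cauchy_schwarz)
    also have "\<dots> \<le> (\<alpha> * norm (?e \<omega>)) * norm (?e \<omega>)"
      using lipschitz_onD[OF pgrad_lipschitz[OF t], of "x m \<omega>" "target m \<omega>"]
      by (intro mult_right_mono) (auto simp: dist_norm)
    finally show "pgrad t (x m \<omega>) \<bullet> ?e \<omega> - pgrad t (target m \<omega>) \<bullet> ?e \<omega> \<le> \<alpha> * (norm (?e \<omega>))\<^sup>2"
      by (simp add: power2_eq_square mult.assoc)
  qed (use integrable_pgrad_dev[OF m t] in simp)
  also have "\<dots> \<le> \<alpha> * (4 * D\<^sup>2 / K)"
    using mult_left_mono[OF expectation_sq_dev_le[OF m] \<alpha>] by simp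
  finally show ?thesis .
qed

section \<open>Regret of the linearized losses\<close>

lemma block_round_in: "m \<in> {1..N} \<Longrightarrow> t \<in> {(m - 1) * K + 1..m * K} \<Longrightarrow> t \<in> {1..T}"
  using block_end_le[of m] by auto

lemma card_block: "m \<in> {1..N} \<Longrightarrow> card {(m - 1) * K + 1..m * K} = K"
  using block_end_eq[of m] by simp

text \<open>The bound holds for every realization: \<open>delayed_linear_regret\<close> admits
  arbitrary losses, here the block sums of gradients taken at \<open>x m\<close>. They have norm at
  most \<open>K * G\<close>, the missing ones at most \<open>G * (K + dmax)\<close>, and
  \<open>r\<close> is \<open>inverse \<delta>\<close>.\<close>

lemma target_regret_le:
  assumes \<omega>: "\<omega> \<in> space M" and z: "z \<in> S"
  shows "(\<Sum>m=1..N. \<Sum>t=(m - 1) * K + 1..m * K. pgrad t (x m \<omega>) \<bullet> (target m \<omega> - z))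
    \<le> D / \<delta> + real N * (real K * G * D * (DIM('a) * (G * (real K + real dmax)) * \<delta> / 2))"
proof -
  define l where "l m = (\<Sum>t=(m - 1) * K + 1..m * K. grad t (x m \<omega>))" for m
  have l: "(\<Sum>t=(m - 1) * K + 1..m * K. pgrad t (x m \<omega>) \<bullet> (target m \<omega> - z)) = l m \<bullet> (target m \<omega> - z)"
    if "m \<in> {1..N}" for m
    using pgrad_eq[OF x_in[OF \<omega> that]] by (simp add: l_def inner_sum_left)
  have "norm (l m) \<le> real K * G" if m: "m \<in> {1..N}" for m
  proof -
    have "norm (l m) \<le> of_nat (card {(m - 1) * K + 1..m * K}) * G"
      unfolding l_def using grad_bound[OF block_round_in[OF m] x_in[OF \<omega> m]]
      by (intro order_trans[OF norm_sum] sum_bounded_above)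
    then show ?thesis by (simp only: card_block[OF m])
  qed
  moreover have "norm (received m \<omega> - (\<Sum>i=1..m. l i)) \<le> G * (real K + real dmax)" if m: "m \<in> {1..N}" for m
    unfolding l_def
  proof (rule missing_gradients_le[OF run[OF \<omega>] delay(1) _ block_end_le[OF m] delay(2) _ G_nonneg])
    show "norm (grad k (x (block_of K k) \<omega>)) \<le> G" if "k \<in> {1..T}" for k
      using that block_of_range[of k N K] by (intro grad_bound x_in \<omega>) (auto simp: T_eq)
  qed (use m in auto)
  moreover have inv: "b / (2 * inverse \<delta>) = b * \<delta> / 2" for b
    using \<delta>_pos by (simp add: field_simps)
  ultimately have "(\<Sum>m=1..N. l m \<bullet> (target m \<omega> - z))
      \<le> D * inverse \<delta> + real N * (real K * G * D * (DIM('a) * (G * (real K + real dmax)) / (2 * inverse \<delta>)))"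
    unfolding target_def using \<delta>_pos z by (intro delayed_linear_regret) auto
  also have "(\<Sum>m=1..N. l m \<bullet> (target m \<omega> - z))
      = (\<Sum>m=1..N. \<Sum>t=(m - 1) * K + 1..m * K. pgrad t (x m \<omega>) \<bullet> (target m \<omega> - z))"
    by (rule sum.cong[OF refl l[symmetric]])
  finally show ?thesis unfolding inv divide_inverse[of D, symmetric] .
qed

text \<open>Split \<open>x m - z\<close> at \<open>target m\<close>. The deviation costs
  \<open>4 * \<alpha> * D\<^sup>2 / K\<close> in expectation for each of the \<open>N * K\<close>
  rounds; the rest is bounded pathwise by \<open>target_regret_le\<close>.\<close>

lemma linear_regret:
  assumes z: "z \<in> S"
  shows "integrable M (\<lambda>\<omega>. \<Sum>m=1..N. \<Sum>t=(m - 1) * K + 1..m * K. pgrad t (x m \<omega>) \<bullet> (x m \<omega> - z))"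
    and "expectation (\<lambda>\<omega>. \<Sum>m=1..N. \<Sum>t=(m - 1) * K + 1..m * K. pgrad t (x m \<omega>) \<bullet> (x m \<omega> - z))
      \<le> 4 * \<alpha> * D\<^sup>2 * N + D / \<delta> + real N * (real K * G * D * (DIM('a) * (G * (real K + real dmax)) * \<delta> / 2))"
proof -
  let ?B = "D / \<delta> + real N * (real K * G * D * (DIM('a) * (G * (real K + real dmax)) * \<delta> / 2))"
  let ?dev = "\<lambda>\<omega>. \<Sum>m=1..N. \<Sum>t=(m - 1) * K + 1..m * K. pgrad t (x m \<omega>) \<bullet> (x m \<omega> - target m \<omega>)"
  let ?R = "\<lambda>\<omega>. \<Sum>m=1..N. \<Sum>t=(m - 1) * K + 1..m * K. pgrad t (x m \<omega>) \<bullet> (x m \<omega> - z)"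
  have int_dev: "integrable M (\<lambda>\<omega>. \<Sum>t=(m - 1) * K + 1..m * K. pgrad t (x m \<omega>) \<bullet> (x m \<omega> - target m \<omega>))"
    if "m \<in> {1..N}" for m
    using that by (intro Bochner_Integration.integrable_sum integrable_pgrad_dev(1) block_round_in)
  then have int_devs: "integrable M ?dev"
    by (rule Bochner_Integration.integrable_sum)
  show int: "integrable M ?R"
  proof (intro Bochner_Integration.integrable_sum)
    fix m t assume "m \<in> {1..N}" "t \<in> {(m - 1) * K + 1..m * K}"
    then show "integrable M (\<lambda>\<omega>. pgrad t (x m \<omega>) \<bullet> (x m \<omega> - z))"
      by (intro integrable_inner_bounded[where a=G and b=D] diam x_in z norm_pgrad_le block_round_in
          borel_measurable_diff x_measurable pgrad_x_measurable borel_measurable_const)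
  qed
  have "?R \<omega> = ?dev \<omega> + (\<Sum>m=1..N. \<Sum>t=(m - 1) * K + 1..m * K. pgrad t (x m \<omega>) \<bullet> (target m \<omega> - z))" for \<omega>
    by (simp add: sum.distrib[symmetric] inner_add_right[symmetric])
  then have le: "?R \<omega> \<le> ?dev \<omega> + ?B" if "\<omega> \<in> space M" for \<omega>
    using target_regret_le[OF that z] by simp
  have "expectation ?R \<le> expectation (\<lambda>\<omega>. ?dev \<omega> + ?B)"
    by (rule integral_mono[OF int Bochner_Integration.integrable_add[OF int_devs integrable_const] le])
  also have "\<dots> = expectation ?dev + ?B"
    using prob_space by (subst Bochner_Integration.integral_add[OF int_devs]) simp_all
  also have "expectation ?dev
      = (\<Sum>m=1..N. \<Sum>t=(m - 1) * K + 1..m * K. expectation (\<lambda>\<omega>. pgrad t (x m \<omega>) \<bullet> (x m \<omega> - target m \<omega>)))"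
  proof -
    have "expectation ?dev
        = (\<Sum>m=1..N. expectation (\<lambda>\<omega>. \<Sum>t=(m - 1) * K + 1..m * K. pgrad t (x m \<omega>) \<bullet> (x m \<omega> - target m \<omega>)))"
      by (rule Bochner_Integration.integral_sum) (rule int_dev)
    then show ?thesis
      by (rule trans) (intro sum.cong[OF refl] Bochner_Integration.integral_sum
          integrable_pgrad_dev(1) block_round_in)
  qed
  also have "\<dots> \<le> (\<Sum>m=1..N. real K * (\<alpha> * (4 * D\<^sup>2 / K)))"
  proof (rule sum_mono)
    fix m assume m: "m \<in> {1..N}"
    show "(\<Sum>t=(m - 1) * K + 1..m * K. expectation (\<lambda>\<omega>. pgrad t (x m \<omega>) \<bullet> (x m \<omega> - target m \<omega>)))
        \<le> real K * (\<alpha> * (4 * D\<^sup>2 / K))"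
      using sum_bounded_above[of "{(m - 1) * K + 1..m * K}", OF expectation_pgrad_dev_le[OF m block_round_in[OF m]]]
      by (simp only: card_block[OF m])
  qed
  also have "\<dots> = 4 * \<alpha> * D\<^sup>2 * N" using K_pos by simp
  finally show "expectation ?R \<le> 4 * \<alpha> * D\<^sup>2 * N + D / \<delta>
      + real N * (real K * G * D * (DIM('a) * (G * (real K + real dmax)) * \<delta> / 2))"
    by simp
qed

end

section \<open>From the linearized regret to the final bound\<close>

theorem theorem3:
  fixes S :: "(real ^ 'n) set"
    and D G \<alpha> \<delta> :: real
    and T K :: nat
    and f :: "nat \<Rightarrow> real ^ 'n \<Rightarrow> real"
    and grad :: "nat \<Rightarrow> real ^ 'n \<Rightarrow> real ^ 'n"
    and d :: "nat \<Rightarrow> nat"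
    and M :: "'w measure"
    and v :: "nat \<Rightarrow> 'w \<Rightarrow> real ^ 'n"
    and y :: "nat \<Rightarrow> nat \<Rightarrow> 'w \<Rightarrow> real ^ 'n"
    and x g :: "nat \<Rightarrow> 'w \<Rightarrow> real ^ 'n"
    and xstar :: "real ^ 'n"
  assumes "closed S" and "convex S" and "0 \<in> S"
    and "\<And>a b. a \<in> S \<Longrightarrow> b \<in> S \<Longrightarrow> norm (a - b) \<le> D"
    and "T \<ge> 1" and "real K = real T powr (1 / 3)"
    and "G > 0"
    and "\<And>t. t \<in> {1..T} \<Longrightarrow> convex_on S (f t)"
    and "\<And>t. t \<in> {1..T} \<Longrightarrow> smooth_over \<alpha> (f t) (grad t) S"
    and "\<And>t a. t \<in> {1..T} \<Longrightarrow> a \<in> S \<Longrightarrow> norm (grad t a) \<le> G"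
    and "\<And>t. t \<in> {1..T} \<Longrightarrow> d t \<ge> 1"
    and "\<delta> = 2 / (sqrt (real CARD('n)) * G * real T powr (2 / 3))"
    and "prob_space M"
    and "prob_space.indep_vars M (\<lambda>_. borel) v {1..T}"
    and "\<And>i. i \<in> {1..T} \<Longrightarrow> distr M borel (v i) = uniform_measure lborel (cball 0 1)"
    and "\<And>m j. m \<in> {1..T div K} \<Longrightarrow> j \<in> {1..K} \<Longrightarrow> y m j \<in> borel_measurable M"
    and "\<And>\<omega>. \<omega> \<in> space M \<Longrightarrow>
      delayed_ospf S T K \<delta> grad d (\<lambda>i. v i \<omega>) (\<lambda>m j. y m j \<omega>) (\<lambda>m. x m \<omega>) (\<lambda>t. g t \<omega>)"
    and "xstar \<in> S"
  defines "regret \<equiv> \<lambda>\<omega>. \<Sum>m=1..T div K. \<Sum>t=(m - 1) * K + 1..m * K. f t (x m \<omega>) - f t xstar"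
  shows "integrable M regret \<and>
    prob_space.expectation M regret \<le>
      4 * \<alpha> * D\<^sup>2 * real T powr (2 / 3)
      + 2 * sqrt (real CARD('n)) * real (Max (d ` {1..T})) * D * G * real T powr (1 / 3)
      + 2 * sqrt (real CARD('n)) * D * G * real T powr (2 / 3)"
proof -
  have K: "K > 0"
    using assms(5,6) by (cases "K = 0") auto
  \<comment> \<open>From \<open>K = T powr (1 / 3)\<close> follows \<open>T = K ^ 3\<close>, so
    there are \<open>K\<^sup>2\<close> blocks.\<close>
  define N where "N = K\<^sup>2"
  have T_K: "real T = real K ^ 3"
    using assms(5) unfolding assms(6) by (simp flip: powr_realpow add: powr_powr)
  then have T: "T = N * K"
    unfolding N_def by (metis of_nat_eq_iff of_nat_power power3_eq_cube power2_eq_square)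
  have TdK: "T div K = N" using K by (simp add: T)
  have T13: "real T powr (1 / 3) = K" using assms(6) by simp
  have T23: "real T powr (2 / 3) = (real K)\<^sup>2"
    unfolding assms(6) using assms(5) by (simp flip: powr_realpow add: powr_powr)
  have bounded: "bounded S"
    unfolding bounded_iff using assms(3) assms(4)[of _ 0] by (intro exI[of _ D]) simp
  then have compact: "compact S" using assms(1) by (simp add: compact_eq_bounded_closed)
  define n where "n = real CARD('n)"
  have n: "n > 0" by (simp add: n_def)
  define dmax where "dmax = Max (d ` {1..T})"
  have \<delta>: "\<delta> = 2 / (sqrt n * G * (real K)\<^sup>2)"
    unfolding assms(12) T23 n_def ..
  have \<delta>_pos: "\<delta> > 0" unfolding \<delta> using n K assms(7) by simp
  interpret R: prob_space M by (rule assms(13))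
  interpret R: delayed_ospf_run S D M v T K N dmax \<delta> G \<alpha> grad d y x g
  proof unfold_locales
    show "\<alpha>-lipschitz_on S (grad t)" if "t \<in> {1..T}" for t
      using assms(9)[OF that] by (simp add: smooth_over_def)
    show "d t \<le> dmax" if "t \<in> {1..T}" for t
      unfolding dmax_def using that by (intro Max_ge) auto
  qed (use assms compact K T \<delta>_pos TdK in \<open>auto simp: less_imp_le\<close>)
  have f_deriv: "(f t has_derivative (\<lambda>h. grad t a \<bullet> h)) (at a within S)" if "t \<in> {1..T}" "a \<in> S" for t a
    using assms(9)[OF that(1)] that(2) by (simp add: smooth_over_def has_gradient_on_def)
  have int: "integrable M (\<lambda>\<omega>. f t (x m \<omega>) - f t xstar)" if t: "t \<in> {1..T}" and m: "m \<in> {1..N}" for t m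
  proof -
    have cont: "continuous_on S (f t)"
      using f_deriv[OF t] by (intro has_derivative_continuous_on)
    have "bounded (f t ` S)"
      using compact_continuous_image[OF cont compact] by (rule compact_imp_bounded)
    then obtain B where B: "\<And>a. a \<in> S \<Longrightarrow> \<bar>f t a\<bar> \<le> B"
      by (auto simp: bounded_iff)
    \<comment> \<open>The losses are only controlled on \<open>S\<close>. Composition with the
      projection gives a globally continuous function that agrees with the loss at
      \<open>x m\<close>, whence measurability.\<close>
    have "continuous_on UNIV (\<lambda>z. f t (closest_point S z))"
      using assms(1-3) R.proj_in
      by (intro continuous_on_compose2[OF cont continuous_on_closest_point]) auto
    then have "(\<lambda>\<omega>. f t (closest_point S (x m \<omega>))) \<in> borel_measurable M"
      by (intro measurable_compose[OF R.x_measurable[OF m]] borel_measurable_continuous_onI)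
    then have "(\<lambda>\<omega>. f t (x m \<omega>)) \<in> borel_measurable M"
      by (subst measurable_cong[where g="\<lambda>\<omega>. f t (closest_point S (x m \<omega>))"])
        (simp_all add: closest_point_self R.x_in[OF _ m])
    then have "integrable M (\<lambda>\<omega>. f t (x m \<omega>))"
      using B R.x_in[OF _ m] by (intro R.integrable_const_bound[where B=B] AE_I2) auto
    then show ?thesis by simp
  qed
  have regret: "regret = (\<lambda>\<omega>. \<Sum>m=1..N. \<Sum>t=(m - 1) * K + 1..m * K. f t (x m \<omega>) - f t xstar)"
    unfolding regret_def TdK ..
  have int_regret: "integrable M regret"
    unfolding regret using int R.block_round_in by (intro Bochner_Integration.integrable_sum) blast
  let ?lin = "\<lambda>\<omega>. \<Sum>m=1..N. \<Sum>t=(m - 1) * K + 1..m * K. R.pgrad t (x m \<omega>) \<bullet> (x m \<omega> - xstar)"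
  have "regret \<omega> \<le> ?lin \<omega>" if \<omega>: "\<omega> \<in> space M" for \<omega>
    unfolding regret
  proof (intro sum_mono)
    fix m t assume m: "m \<in> {1..N}" and "t \<in> {(m - 1) * K + 1..m * K}"
    then have t: "t \<in> {1..T}" by (rule R.block_round_in)
    have "x m \<omega> \<in> S" using \<omega> m by (rule R.x_in)
    then show "f t (x m \<omega>) - f t xstar \<le> R.pgrad t (x m \<omega>) \<bullet> (x m \<omega> - xstar)"
      using convex_on_above_gradient[OF assms(8)[OF t] f_deriv[OF t]] assms(18)
      by (simp add: R.pgrad_eq)
  qed
  then have "R.expectation regret \<le> R.expectation ?lin"
    by (intro integral_mono int_regret R.linear_regret assms(18))
  also have "\<dots> \<le> 4 * \<alpha> * D\<^sup>2 * N + D / \<delta>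
      + real N * (real K * G * D * (DIM(real ^ 'n) * (G * (real K + real dmax)) * \<delta> / 2))"
    by (rule R.linear_regret(2)[OF assms(18)])
  \<comment> \<open>Substitution of \<open>N = K\<^sup>2\<close> and of \<open>\<delta>\<close>: one
    factor \<open>G\<close> and a factor \<open>sqrt n\<close> cancel in the delay term.\<close>
  also have "\<dots> = 4 * \<alpha> * D\<^sup>2 * (real K)\<^sup>2 + sqrt n * G * D * (real K)\<^sup>2 / 2
      + sqrt n * G * D * real K * (real K + real dmax)"
  proof -
    define q where "q = sqrt n"
    have q: "q > 0" "n = q * q" using n by (simp_all add: q_def)
    have a: "D / \<delta> = q * G * D * (real K)\<^sup>2 / 2"
      unfolding \<delta> q_def[symmetric] using q K assms(7) by simp
    have b: "real N * (real K * G * D * (DIM(real ^ 'n) * (G * (real K + real dmax)) * \<delta> / 2))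
        = q * G * D * real K * (real K + real dmax)"
    proof -
      have "real (DIM(real ^ 'n)) = q * q" using q(2) by (simp add: n_def)
      then show ?thesis
        unfolding \<delta> q_def[symmetric] N_def using q(1) K assms(7) by (simp add: field_simps)
    qed
    show ?thesis unfolding a b unfolding q_def N_def by simp
  qed
  \<comment> \<open>The terms in \<open>K\<^sup>2\<close> add up to the coefficient 3/2 and the
    delay term has coefficient 1; both are rounded up to 2.\<close>
  also have "\<dots> \<le> 4 * \<alpha> * D\<^sup>2 * (real K)\<^sup>2 + 2 * sqrt n * real dmax * D * G * real K
      + 2 * sqrt n * D * G * (real K)\<^sup>2"
  proof -
    define c where "c = sqrt n * G * D"
    have c: "0 \<le> c" using n assms(7) R.D_nonneg by (simp add: c_def)
    have nonneg: "0 \<le> c * (real K)\<^sup>2" "0 \<le> c * (real K * real dmax)" using c by simp_all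
    have e: "sqrt n * G * D * (real K)\<^sup>2 / 2 = c * (real K)\<^sup>2 / 2"
      "sqrt n * G * D * real K * (real K + real dmax) = c * (real K)\<^sup>2 + c * (real K * real dmax)"
      "2 * sqrt n * real dmax * D * G * real K = 2 * (c * (real K * real dmax))"
      "2 * sqrt n * D * G * (real K)\<^sup>2 = 2 * (c * (real K)\<^sup>2)"
      by (simp_all add: c_def algebra_simps power2_eq_square)
    show ?thesis unfolding e using nonneg by simp
  qed
  finally show ?thesis
    using int_regret unfolding T13 T23 n_def dmax_def by simp
qed

end
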